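(* $\widehat{\mathcal O}_\theta$ is a topological field (for the inframetric topology) containing $K$, i.e. the embedding $\mathcal O_K\hookrightarrow\widehat{\mathcal O}_\theta$ extends to an embedding of the field $K$.
   Context: $\theta>1$ is a real quadratic unit with $N(\theta)=1$, so $\theta^2=a\theta-1$ with an integer $a\ge3$ and $\theta'=\theta^{-1}$; $K=\mathbb Q(\theta)\subset\mathbb R$, $\mathcal O_K$ its ring of integers, $\alpha'$ the Galois conjugate. A greedy polynomial is a finite sum $\sum_{i=m}^M b_i\theta^i$ with $b_i\in\{0,\dots,a-1\}$ containing no digit subword $b_ib_{i-1}\cdots b_{i-k}$ ($k\ge1$) of the form $(a-1)(a-2)\cdots(a-2)(a-1)$ (including $(a-1)(a-1)$). Let $\mathcal O_K^0=\{\alpha\in\mathcal O_K:\operatorname{sgn}\alpha=\operatorname{sgn}\alpha'\}\cup\{0\}$ and $\mathcal O_K^1=\{\alpha\in\mathcal O_K:\operatorname{sgn}\alpha\ne\operatorname{sgn}\alpha'\}\cup\{0\}$. Each nonzero $\alpha\in\mathcal O_K^0$ is uniquely $\pm$ a greedy polynomial $\sum_{i=m}^Mb_i\theta^i$ with $b_m\ne0$; set $|\alpha|_\theta=\theta^{-m}$, $|0|_\theta=0$. With $T=\theta-1$, for $\alpha\in\mathcal O_K^1$ one has $T\alpha\in\mathcal O_K^0$ and $|\alpha|_\theta:=|T\alpha|_\theta$. $\widehat{\mathcal O}_\theta=\mathcal R_\theta/\mathcal M_\theta$, where $\mathcal R_\theta$ is the ring (componentwise operations) of sequences $(f_n)$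 in $\mathcal O_K$ Cauchy for $|\cdot|_\theta$ (for every $\varepsilon>0$ there is $N$ with $|f_i-f_j|_\theta<\varepsilon$ for $i,j\ge N$) and $\mathcal M_\theta$ the ideal of those with $|f_n|_\theta\to0$; $\mathcal O_K$ embeds via constant sequences. For $\hat h\in\widehat{\mathcal O}_\theta$ put $|\hat h|_\theta:=\max_{(h_i)\in\hat h}\limsup_i|h_i|_\theta$ (maximum over representing sequences). The inframetric topology is the unique topology in which, for each $\hat f$, the sets $\{\hat g:|\hat f-\hat g|_\theta<\varepsilon\}$, $\varepsilon>0$, form a base of the neighbourhood filter of $\hat f$.
   Formalization: The formal theorem assumes O_K = Z[θ]; otherwise |·|_θ is undefined on O_K (for a = 6, θ = 3+2√2, the totally positive 2+√2 in O_K is not in Z[θ] and so is not a greedy polynomial). *)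

theory Defs
  imports
    "HOL-Library.Extended_Real"
    "HOL-Computational_Algebra.Polynomial"
    "HOL-Analysis.Product_Topology"
    "HOL-Algebra.QuotRing"
begin

section \<open>The quadratic field\<close>

text \<open>
  Throughout, \<open>\<theta>\<close> is a real root of \<open>x\<^sup>2 - a x + 1\<close> with \<open>a \<ge> 3\<close> and \<open>\<theta> > 1\<close>. It is irrational
  and its conjugate is \<open>1 / \<theta>\<close>, so \<open>1, \<theta>\<close> is a \<open>\<rat>\<close>-basis of \<open>\<rat>(\<theta>)\<close>.
\<close>

definition quad_field :: "real \<Rightarrow> real set" where
  "quad_field \<theta> = {of_rat p + of_rat q * \<theta> | p q. True}"

definition quad_field_ring :: "real \<Rightarrow> real ring" where
  "quad_field_ring \<theta> =
     \<lparr>carrier = quad_field \<theta>, mult = (*), one = 1, zero = 0, add = (+)\<rparr>"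

definition conj_of :: "real \<Rightarrow> real \<Rightarrow> real" where
  "conj_of \<theta> x =
     (THE y. \<exists>p q. x = of_rat p + of_rat q * \<theta> \<and> y = of_rat p + of_rat q * inverse \<theta>)"

definition int_ring :: "real \<Rightarrow> real set" where
  "int_ring \<theta> = {x \<in> quad_field \<theta>. algebraic_int x}"

text \<open>
  The order \<open>\<int>[\<theta>]\<close>. As \<open>1 / \<theta> = a - \<theta>\<close>, all greedy polynomials lie in it, so the absolute value
  below is meaningful on the full ring of integers only if that ring is \<open>\<int>[\<theta>]\<close>.
\<close>

definition Z_adjoin :: "real \<Rightarrow> real set" where
  "Z_adjoin \<theta> = {of_int x + of_int y * \<theta> | x y. True}"

definition int_ring0 :: "real \<Rightarrow> real set" where
  "int_ring0 \<theta> = {x \<in> int_ring \<theta>. sgn x = sgn (conj_of \<theta> x)} \<union> {0}"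

definition int_ring1 :: "real \<Rightarrow> real set" where
  "int_ring1 \<theta> = {x \<in> int_ring \<theta>. sgn x \<noteq> sgn (conj_of \<theta> x)} \<union> {0}"


section \<open>Greedy polynomials and the absolute value\<close>

text \<open>The last condition excludes the digit words \<open>(a-1)(a-2)\<dots>(a-2)(a-1)\<close>.\<close>

definition greedy_digits :: "int \<Rightarrow> int \<Rightarrow> int \<Rightarrow> (int \<Rightarrow> int) \<Rightarrow> bool" where
  "greedy_digits a m M b \<longleftrightarrow>
     m \<le> M \<and>
     (\<forall>i\<in>{m..M}. b i \<in> {0..a - 1}) \<and>
     \<not> (\<exists>i k. 1 \<le> k \<and> m \<le> i - k \<and> i \<le> M \<and>
            b i = a - 1 \<and> b (i - k) = a - 1 \<and> (\<forall>j\<in>{i - k<..<i}. b j = a - 2))"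

text \<open>
  The absolute value of a nonzero \<open>\<alpha>\<close> in \<open>int_ring0 \<theta>\<close>: \<open>m\<close> is the lowest exponent of the greedy
  polynomial equal to \<open>\<alpha>\<close> or \<open>- \<alpha>\<close>.
\<close>

definition theta_abs0 :: "int \<Rightarrow> real \<Rightarrow> real \<Rightarrow> real" where
  "theta_abs0 a \<theta> \<alpha> =
     (if \<alpha> = 0 then 0
      else \<theta> powi (- (THE m. \<exists>M b s. greedy_digits a m M b \<and> b m \<noteq> 0 \<and> s \<in> {1, -1} \<and>
                               \<alpha> = s * (\<Sum>i=m..M. of_int (b i) * \<theta> powi i))))"

definition theta_abs :: "int \<Rightarrow> real \<Rightarrow> real \<Rightarrow> real" where
  "theta_abs a \<theta> \<alpha> =
     (if \<alpha> \<in> int_ring1 \<theta> then theta_abs0 a \<theta> ((\<theta> - 1) * \<alpha>) else theta_abs0 a \<theta> \<alpha>)"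


section \<open>The completion\<close>

definition theta_Cauchy :: "int \<Rightarrow> real \<Rightarrow> (nat \<Rightarrow> real) \<Rightarrow> bool" where
  "theta_Cauchy a \<theta> f \<longleftrightarrow>
     (\<forall>\<epsilon>>0. \<exists>N. \<forall>i\<ge>N. \<forall>j\<ge>N. theta_abs a \<theta> (f i - f j) < \<epsilon>)"

definition Cauchy_ring :: "int \<Rightarrow> real \<Rightarrow> (nat \<Rightarrow> real) ring" where
  "Cauchy_ring a \<theta> =
     \<lparr>carrier = {f. range f \<subseteq> int_ring \<theta> \<and> theta_Cauchy a \<theta> f},
      mult = (\<lambda>f g n. f n * g n), one = (\<lambda>n. 1),
      zero = (\<lambda>n. 0), add = (\<lambda>f g n. f n + g n)\<rparr>"

definition null_ideal :: "int \<Rightarrow> real \<Rightarrow> (nat \<Rightarrow> real) set" where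
  "null_ideal a \<theta> =
     {f \<in> carrier (Cauchy_ring a \<theta>). (\<lambda>n. theta_abs a \<theta> (f n)) \<longlonglongrightarrow> 0}"

definition completion :: "int \<Rightarrow> real \<Rightarrow> (nat \<Rightarrow> real) set ring" where
  "completion a \<theta> = Cauchy_ring a \<theta> Quot null_ideal a \<theta>"

definition const_embed :: "int \<Rightarrow> real \<Rightarrow> real \<Rightarrow> (nat \<Rightarrow> real) set" where
  "const_embed a \<theta> \<alpha> = null_ideal a \<theta> +>\<^bsub>Cauchy_ring a \<theta>\<^esub> (\<lambda>n. \<alpha>)"

text \<open>\<open>Greatest\<close> is the maximum over all representatives \<open>h\<close> of the class \<open>H\<close>.\<close>

definition completion_abs :: "int \<Rightarrow> real \<Rightarrow> (nat \<Rightarrow> real) set \<Rightarrow> ereal" where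
  "completion_abs a \<theta> H =
     (GREATEST v. \<exists>h\<in>H. v = limsup (\<lambda>i. ereal (theta_abs a \<theta> (h i))))"

definition completion_ball ::
  "int \<Rightarrow> real \<Rightarrow> (nat \<Rightarrow> real) set \<Rightarrow> real \<Rightarrow> (nat \<Rightarrow> real) set set" where
  "completion_ball a \<theta> F \<epsilon> =
     {G \<in> carrier (completion a \<theta>). completion_abs a \<theta> (F \<ominus>\<^bsub>completion a \<theta>\<^esub> G) < ereal \<epsilon>}"

text \<open>
  Neighbourhoods of a point need not be open; the balls are not required to be open either, only
  to form a base of the neighbourhood filter of their centre.
\<close>

definition inframetric_topology :: "int \<Rightarrow> real \<Rightarrow> (nat \<Rightarrow> real) set topology" where
  "inframetric_topology a \<theta> =
     (THE X. topspace X = carrier (completion a \<theta>) \<and>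
        (\<forall>F \<in> carrier (completion a \<theta>). \<forall>U \<subseteq> carrier (completion a \<theta>).
           (\<exists>V. openin X V \<and> F \<in> V \<and> V \<subseteq> U) \<longleftrightarrow>
           (\<exists>\<epsilon>>0. completion_ball a \<theta> F \<epsilon> \<subseteq> U)))"


section \<open>Topological fields\<close>

definition topological_field :: "('b, 'm) ring_scheme \<Rightarrow> 'b topology \<Rightarrow> bool" where
  "topological_field R X \<longleftrightarrow>
     field R \<and> topspace X = carrier R \<and>
     continuous_map (prod_topology X X) X (\<lambda>(x, y). x \<oplus>\<^bsub>R\<^esub> y) \<and>
     continuous_map X X (\<lambda>x. \<ominus>\<^bsub>R\<^esub> x) \<and>
     continuous_map (prod_topology X X) X (\<lambda>(x, y). x \<otimes>\<^bsub>R\<^esub> y) \<and>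
     continuous_map (subtopology X (carrier R - {\<zero>\<^bsub>R\<^esub>})) X (\<lambda>x. inv\<^bsub>R\<^esub> x)"

end

theory Submission
  imports
    Defs
    "HOL-Library.Multiset"
    "HOL-Analysis.Abstract_Limits"
    "HOL-Analysis.Extended_Real_Limits"
begin

text \<open>
  The set of forbidden digit words is closed under reversal, so the conjugate
  \<open>\<Sum> b\<^sub>i \<theta>\<^sup>-\<^sup>i\<close> of a greedy polynomial is again a greedy polynomial, whose highest exponent is
  \<open>- m\<close>. As in any greedy expansion this gives \<open>\<theta>\<^sup>-\<^sup>m \<le> \<bar>\<alpha>'\<bar> < \<theta>\<^sup>1\<^sup>-\<^sup>m\<close>. Hence \<open>|\<alpha>|\<^sub>\<theta>\<close> agrees with the
  archimedean absolute value \<open>\<bar>\<alpha>'\<bar>\<close> up to bounded factors, and since the conjugates of \<open>\<int>[\<theta>]\<close>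
  are dense in the reals, \<open>lim f\<^sub>n'\<close> identifies the completion with the topological field of real
  numbers; the field embeds through \<open>\<alpha> \<mapsto> \<alpha>'\<close>.
\<close>

subsection \<open>Arithmetic of the quadratic field\<close>

text \<open>The definite description in \<open>theta_abs0\<close> needs a lowest exponent that
  exists and is unique. Existence is an extremal argument: a totally positive element of Z[\<theta>]
  is a sum of powers of \<theta> with repetitions, and a sum with the fewest summands is greedy,
  because a forbidden word, or a digit reaching \<open>a\<close>, can be traded for fewer powers.
  Uniqueness holds because the windows \<open>[\<theta> powi (- m), \<theta> powi (1 - m))\<close>
  for the conjugate are disjoint. The obstacle afterwards is that \<open>theta_abs\<close> has only
  powers of \<theta> as nonzero values. It jumps while the conjugate varies continuously, and its
  limsup can depend on the representing sequence. So the completion is studied through the two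
  inequalities \<open>theta_abs a \<theta> \<alpha> \<le> \<bar>cj \<alpha>\<bar> \<le> ratio *
  theta_abs a \<theta> \<alpha>\<close>; the discreteness of the values is turned to advantage once,
  to show that the maximum in \<open>completion_abs\<close> is attained.\<close>

locale quadratic_unit =
  fixes a :: int and \<theta> :: real
  assumes a_ge: "3 \<le> a" and gt_1: "1 < \<theta>" and square: "\<theta>\<^sup>2 = of_int a * \<theta> - 1"
begin

abbreviation cj :: "real \<Rightarrow> real" where
  "cj \<equiv> conj_of \<theta>"

lemma pos: "0 < \<theta>"
  using gt_1 by simp

lemma inverse_eq: "inverse \<theta> = of_int a - \<theta>"
  using square gt_1 by (simp add: field_simps power2_eq_square)

text \<open>A rational algebraic integer is an integer, and an integer root would divide the
  constant term 1, against \<open>\<theta> > 1\<close>.\<close>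

lemma irrational: "\<theta> \<notin> \<rat>"
proof
  assume "\<theta> \<in> \<rat>"
  moreover have "algebraic_int \<theta>"
  proof (rule algebraic_int.intros)
    show "lead_coeff [:1, - of_int a, 1 :: real:] = 1"
      by simp
    show "\<forall>i. coeff [:1, - of_int a, 1 :: real:] i \<in> \<int>"
      by (auto simp: coeff_pCons split: nat.splits)
    show "poly [:1, - of_int a, 1:] \<theta> = 0"
      using square by (simp add: algebra_simps power2_eq_square)
  qed
  ultimately have "\<theta> \<in> \<int>"
    using rational_algebraic_int_is_int by blast
  then obtain n :: int where n: "\<theta> = of_int n"
    by (auto elim: Ints_cases)
  have "(of_int (n * (a - n)) :: real) = of_int 1"
    using square unfolding n by (simp add: algebra_simps power2_eq_square)
  then have "n * (a - n) = 1"
    using of_int_eq_iff by blast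
  then have "n = 1 \<or> n = -1"
    by (metis dvd_triv_left zdvd1_eq abs_eq_iff abs_one)
  then show False
    using n gt_1 by auto
qed

text \<open>Makes the definite description in \<open>conj_of\<close> unambiguous, and later gives
  the injectivity of \<open>cj\<close>.\<close>

lemma of_rat_basis_eq_iff:
  "(of_rat p + of_rat q * \<theta> = of_rat r + of_rat s * \<theta>) \<longleftrightarrow> p = r \<and> q = s"
proof
  assume eq: "of_rat p + of_rat q * \<theta> = of_rat r + of_rat s * \<theta>"
  have "q = s"
  proof (rule ccontr)
    assume "q \<noteq> s"
    then have "\<theta> = of_rat ((r - p) / (q - s))"
      using eq by (simp add: of_rat_divide of_rat_diff field_simps)
    then show False
      using irrational by auto
  qed
  with eq show "p = r \<and> q = s"
    by simp
qed simp

lemma conj_of_rat: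
  "cj (of_rat p + of_rat q * \<theta>) = of_rat p + of_rat q * inverse \<theta>"
  unfolding conj_of_def by (rule the_equality) (auto simp: of_rat_basis_eq_iff)

lemma conj_of_int:
  "cj (of_int x + of_int y * \<theta>) = of_int x + of_int y * inverse \<theta>"
  using conj_of_rat[of "of_int x" "of_int y"] by simp

lemma Z_adjoin_subset: "Z_adjoin \<theta> \<subseteq> quad_field \<theta>"
  unfolding Z_adjoin_def quad_field_def by (auto, metis of_rat_of_int_eq)

lemma quad_field_add: "x \<in> quad_field \<theta> \<Longrightarrow> y \<in> quad_field \<theta> \<Longrightarrow> x + y \<in> quad_field \<theta>"
  and conj_add: "x \<in> quad_field \<theta> \<Longrightarrow> y \<in> quad_field \<theta> \<Longrightarrow> cj (x + y) = cj x + cj y"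
proof -
  assume "x \<in> quad_field \<theta>" "y \<in> quad_field \<theta>"
  then obtain p q r s where x: "x = of_rat p + of_rat q * \<theta>" and y: "y = of_rat r + of_rat s * \<theta>"
    by (auto simp: quad_field_def)
  have xy: "x + y = of_rat (p + r) + of_rat (q + s) * \<theta>"
    by (simp add: x y of_rat_add algebra_simps)
  show "x + y \<in> quad_field \<theta>"
    unfolding quad_field_def xy by blast
  show "cj (x + y) = cj x + cj y"
    unfolding xy conj_of_rat unfolding x y conj_of_rat by (simp add: of_rat_add algebra_simps)
qed

lemma quad_field_mult: "x \<in> quad_field \<theta> \<Longrightarrow> y \<in> quad_field \<theta> \<Longrightarrow> x * y \<in> quad_field \<theta>"
  and conj_mult: "x \<in> quad_field \<theta> \<Longrightarrow> y \<in> quad_field \<theta> \<Longrightarrow> cj (x * y) = cj x * cj y"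
proof -
  assume "x \<in> quad_field \<theta>" "y \<in> quad_field \<theta>"
  then obtain p q r s where x: "x = of_rat p + of_rat q * \<theta>" and y: "y = of_rat r + of_rat s * \<theta>"
    by (auto simp: quad_field_def)
  have inverse_square: "inverse \<theta> * inverse \<theta> = of_int a * inverse \<theta> - 1"
    using square pos by (simp add: field_simps power2_eq_square)
  have xy: "x * y = of_rat (p * r - q * s) + of_rat (p * s + q * r + of_int a * q * s) * \<theta>"
  proof -
    have "x * y = of_rat p * of_rat r + of_rat q * of_rat s * \<theta>\<^sup>2
        + (of_rat p * of_rat s + of_rat q * of_rat r) * \<theta>"
      by (simp add: x y algebra_simps power2_eq_square)
    then show ?thesis
      unfolding square by (simp add: of_rat_add of_rat_mult of_rat_diff algebra_simps)
  qed
  show "x * y \<in> quad_field \<theta>"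
    unfolding quad_field_def xy by blast
  have "cj x * cj y = of_rat p * of_rat r + of_rat q * of_rat s * (inverse \<theta> * inverse \<theta>)
        + (of_rat p * of_rat s + of_rat q * of_rat r) * inverse \<theta>"
    unfolding x y conj_of_rat by (simp add: algebra_simps)
  then show "cj (x * y) = cj x * cj y"
    unfolding xy conj_of_rat inverse_square
    by (simp add: of_rat_add of_rat_mult of_rat_diff algebra_simps)
qed

lemma quad_field_of_rat [simp]: "of_rat p \<in> quad_field \<theta>"
  unfolding quad_field_def by (rule CollectI, rule exI[of _ p], rule exI[of _ 0]) simp

lemma conj_of_rat_rat [simp]: "cj (of_rat p) = of_rat p"
  using conj_of_rat[of p 0] by simp

lemma conj_0 [simp]: "cj 0 = 0" and conj_1 [simp]: "cj 1 = 1"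
  using conj_of_rat_rat[of 0] conj_of_rat_rat[of 1] by simp_all

lemma conj_theta [simp]: "cj \<theta> = inverse \<theta>"
  using conj_of_rat[of 0 1] by simp

lemma quad_field_uminus: "x \<in> quad_field \<theta> \<Longrightarrow> - x \<in> quad_field \<theta>"
  using quad_field_mult[of "-1" x] quad_field_of_rat[of "-1"] by simp

lemma conj_uminus: "x \<in> quad_field \<theta> \<Longrightarrow> cj (- x) = - cj x"
  using conj_mult[of "-1" x] quad_field_of_rat[of "-1"] conj_of_rat_rat[of "-1"] by simp

lemma conj_diff: "x \<in> quad_field \<theta> \<Longrightarrow> y \<in> quad_field \<theta> \<Longrightarrow> cj (x - y) = cj x - cj y"
  using conj_add[of x "- y"] quad_field_uminus[of y] conj_uminus[of y] by simp

lemma conj_eq_0_iff: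
  assumes "x \<in> quad_field \<theta>"
  shows "cj x = 0 \<longleftrightarrow> x = 0"
proof
  obtain p q where x: "x = of_rat p + of_rat q * \<theta>"
    using assms by (auto simp: quad_field_def)
  assume "cj x = 0"
  then have *: "of_rat p + of_rat q * (of_int a - \<theta>) = 0"
    by (simp add: x conj_of_rat inverse_eq)
  have "of_rat (p + q * of_int a) + of_rat (- q) * \<theta> = of_rat 0 + of_rat 0 * \<theta>"
    using * by (simp add: of_rat_add of_rat_mult of_rat_minus algebra_simps)
  then show "x = 0"
    unfolding of_rat_basis_eq_iff by (auto simp: x)
qed simp

lemma inj_on_conj: "inj_on cj (quad_field \<theta>)"
proof (rule inj_onI)
  fix x y assume *: "x \<in> quad_field \<theta>" "y \<in> quad_field \<theta>" "cj x = cj y"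
  then have "x - y \<in> quad_field \<theta>" "cj (x - y) = 0"
    using quad_field_add[of x "- y"] quad_field_uminus[of y] conj_diff[of x y] by auto
  then show "x = y"
    by (simp add: conj_eq_0_iff)
qed

section \<open>The order Z[\<theta>] and the integer powers of \<theta>\<close>

lemma Z_adjoin_of_int [simp]: "of_int n \<in> Z_adjoin \<theta>"
  unfolding Z_adjoin_def by (rule CollectI, rule exI[of _ n], rule exI[of _ 0]) simp

lemma Z_adjoin_0 [simp]: "0 \<in> Z_adjoin \<theta>" and Z_adjoin_1 [simp]: "1 \<in> Z_adjoin \<theta>"
  using Z_adjoin_of_int[of 0] Z_adjoin_of_int[of 1] by simp_all

lemma Z_adjoin_theta [simp]: "\<theta> \<in> Z_adjoin \<theta>"
  unfolding Z_adjoin_def by (rule CollectI, rule exI[of _ 0], rule exI[of _ 1]) simp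

lemma Z_adjoin_add: "x \<in> Z_adjoin \<theta> \<Longrightarrow> y \<in> Z_adjoin \<theta> \<Longrightarrow> x + y \<in> Z_adjoin \<theta>"
proof -
  assume "x \<in> Z_adjoin \<theta>" "y \<in> Z_adjoin \<theta>"
  then obtain p q r s where x: "x = of_int p + of_int q * \<theta>" and y: "y = of_int r + of_int s * \<theta>"
    by (auto simp: Z_adjoin_def)
  have xy: "x + y = of_int (p + r) + of_int (q + s) * \<theta>"
    by (simp add: x y algebra_simps)
  show ?thesis
    unfolding Z_adjoin_def xy by blast
qed

lemma Z_adjoin_mult: "x \<in> Z_adjoin \<theta> \<Longrightarrow> y \<in> Z_adjoin \<theta> \<Longrightarrow> x * y \<in> Z_adjoin \<theta>"
proof -
  assume "x \<in> Z_adjoin \<theta>" "y \<in> Z_adjoin \<theta>"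
  then obtain p q r s where x: "x = of_int p + of_int q * \<theta>" and y: "y = of_int r + of_int s * \<theta>"
    by (auto simp: Z_adjoin_def)
  have "x * y = of_int p * of_int r + of_int q * of_int s * \<theta>\<^sup>2
        + (of_int p * of_int s + of_int q * of_int r) * \<theta>"
    by (simp add: x y algebra_simps power2_eq_square)
  then have xy: "x * y = of_int (p * r - q * s) + of_int (p * s + q * r + a * q * s) * \<theta>"
    unfolding square by (simp add: algebra_simps)
  show ?thesis
    unfolding Z_adjoin_def xy by blast
qed

lemma Z_adjoin_uminus: "x \<in> Z_adjoin \<theta> \<Longrightarrow> - x \<in> Z_adjoin \<theta>"
  using Z_adjoin_mult[of "-1" x] Z_adjoin_of_int[of "-1"] by simp

lemma Z_adjoin_diff: "x \<in> Z_adjoin \<theta> \<Longrightarrow> y \<in> Z_adjoin \<theta> \<Longrightarrow> x - y \<in> Z_adjoin \<theta>"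
  using Z_adjoin_add[of x "- y"] Z_adjoin_uminus[of y] by simp

lemma Z_adjoin_inverse: "inverse \<theta> \<in> Z_adjoin \<theta>"
  unfolding inverse_eq by (intro Z_adjoin_diff) simp_all

lemma conj_inverse_theta: "cj (inverse \<theta>) = \<theta>"
proof -
  have "cj (inverse \<theta>) = cj (of_int a + of_int (-1) * \<theta>)"
    by (simp add: inverse_eq)
  then show ?thesis
    unfolding conj_of_int by (simp add: inverse_eq)
qed

lemma power_conj:
  assumes "x \<in> Z_adjoin \<theta>"
  shows "x ^ n \<in> Z_adjoin \<theta> \<and> cj (x ^ n) = cj x ^ n"
proof (induction n)
  case (Suc n)
  then show ?case
    using assms Z_adjoin_subset by (auto simp: Z_adjoin_mult conj_mult subset_iff)
qed simp

lemma powi_conj: "\<theta> powi i \<in> Z_adjoin \<theta> \<and> cj (\<theta> powi i) = \<theta> powi (- i)"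
proof (cases "i \<ge> 0")
  case True
  then show ?thesis
    using power_conj[OF Z_adjoin_theta, of "nat i"]
    by (auto simp: power_int_def power_inverse)
next
  case False
  then show ?thesis
    using power_conj[OF Z_adjoin_inverse, of "nat (- i)"]
    by (auto simp: power_int_def conj_inverse_theta power_inverse)
qed

lemma powi_add: "\<theta> powi (i + j) = \<theta> powi i * \<theta> powi j"
  using pos by (intro power_int_add) simp

lemma powi_pos [simp]: "0 < \<theta> powi i"
  using pos by (rule zero_less_power_int)

text \<open>The trace relation \<open>\<theta> + inverse \<theta> = a\<close>, scaled by a power;
  the rewriting of digit words rests on it.\<close>

lemma powi_recurrence: "of_int a * \<theta> powi i = \<theta> powi (i + 1) + \<theta> powi (i - 1)"
proof -
  have "of_int a = \<theta> + inverse \<theta>"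
    by (simp add: inverse_eq)
  then have "of_int a * \<theta> powi i = \<theta> powi i * \<theta> + \<theta> powi i * inverse \<theta>"
    by (simp add: algebra_simps)
  then show ?thesis
    using powi_add[of i 1] powi_add[of i "-1"] by (simp add: power_int_minus)
qed

lemma sum_conj:
  "(\<Sum>i\<in>I. of_int (b i) * \<theta> powi i) \<in> Z_adjoin \<theta> \<and>
     cj (\<Sum>i\<in>I. of_int (b i) * \<theta> powi i) = (\<Sum>i\<in>I. of_int (b i) * \<theta> powi (- i))"
proof (induction I rule: infinite_finite_induct)
  case (insert i I)
  have *: "of_int (b i) * \<theta> powi i \<in> Z_adjoin \<theta>"
    using powi_conj[of i] by (intro Z_adjoin_mult) simp_all
  have "cj (of_int (b i) * \<theta> powi i) = of_int (b i) * \<theta> powi (- i)"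
    using powi_conj[of i] conj_mult[of "of_int (b i)" "\<theta> powi i"] Z_adjoin_subset
      conj_of_int[of "b i" 0] by (auto simp: subset_iff)
  then show ?case
    using insert * Z_adjoin_subset by (auto simp: Z_adjoin_add conj_add subset_iff)
qed simp_all

subsection \<open>Existence of greedy expansions\<close>

text \<open>Consecutive powers \<open>\<theta>\<^sup>i\<close>, \<open>\<theta>\<^bsup>i+1\<^esup>\<close> form a basis of \<open>\<int>[\<theta>]\<close>, and the cones they span cover all
  totally positive elements.\<close>

lemma totally_positive_imp_sum_powers:
  assumes "\<alpha> \<in> Z_adjoin \<theta>" "0 < \<alpha>" "0 < cj \<alpha>"
  shows "\<exists>A. \<alpha> = (\<Sum>i\<in>#A. \<theta> powi i)"
proof -
  \<comment> \<open>Multiplying \<alpha> by \<theta> multiplies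
    \<open>\<alpha> / cj \<alpha>\<close> by \<open>\<theta>\<^sup>2\<close>. This \<open>i\<close>
    moves the quotient for \<beta> into \<open>[1, \<theta>\<^sup>2)\<close>, between its values at
    1 and at \<theta>, so that \<beta> lies in the cone of these two.\<close>
  define i where "i = \<lfloor>log \<theta> (\<alpha> / cj \<alpha>) / 2\<rfloor>"
  define \<beta> where "\<beta> = \<alpha> * \<theta> powi (- i)"
  have \<beta>: "\<beta> \<in> Z_adjoin \<theta>"
    using assms powi_conj[of "- i"] by (simp add: \<beta>_def Z_adjoin_mult)
  have cj_\<beta>: "cj \<beta> = cj \<alpha> * \<theta> powi i"
    using assms powi_conj[of "- i"] Z_adjoin_subset by (auto simp: \<beta>_def conj_mult subset_iff)
  have "of_int (2 * i) \<le> log \<theta> (\<alpha> / cj \<alpha>)" "log \<theta> (\<alpha> / cj \<alpha>) < of_int (2 * i + 2)"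
    unfolding i_def by linarith+
  then have "\<theta> powr of_int (2 * i) \<le> \<alpha> / cj \<alpha>" "\<alpha> / cj \<alpha> < \<theta> powr of_int (2 * i + 2)"
    using assms gt_1 by (simp_all add: le_log_iff log_less_iff)
  then have "\<theta> powi (2 * i) \<le> \<alpha> / cj \<alpha>" "\<alpha> / cj \<alpha> < \<theta> powi (2 * i + 2)"
    using pos by (simp_all add: powr_real_of_int' del: of_int_add of_int_mult)
  then have "\<theta> powi i * \<theta> powi i * cj \<alpha> \<le> \<alpha>" "\<alpha> < \<theta> powi i * \<theta> powi i * \<theta>\<^sup>2 * cj \<alpha>"
    using assms powi_add[of i i] powi_add[of "i + i" 2] by (simp_all add: field_simps)
  then have le: "cj \<beta> \<le> \<beta>" and less: "\<beta> < \<theta>\<^sup>2 * cj \<beta>"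
    unfolding cj_\<beta> by (simp_all add: \<beta>_def power_int_minus field_simps)
  obtain X Y where XY: "\<beta> = of_int X + of_int Y * \<theta>"
    using \<beta> by (auto simp: Z_adjoin_def)
  have XY': "cj \<beta> = of_int X + of_int Y * inverse \<theta>"
    by (simp add: XY conj_of_int)
  \<comment> \<open>Each side of the cone controls one coordinate:
    \<open>\<beta> - cj \<beta>\<close> isolates \<open>Y\<close>, and
    \<open>\<theta>\<^sup>2 * cj \<beta> - \<beta>\<close> isolates \<open>X\<close>.\<close>
  have "0 \<le> of_int Y * (\<theta> - inverse \<theta>)"
    using le XY XY' by (simp add: algebra_simps)
  moreover have "0 < \<theta> - inverse \<theta>"
    using gt_1 inverse_less_1_iff[of \<theta>] by linarith
  ultimately have "0 \<le> Y"
    by (simp add: zero_le_mult_iff)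
  have less': "of_int X + of_int Y * \<theta> < \<theta>\<^sup>2 * (of_int X + of_int Y * inverse \<theta>)"
    using less by (simp only: flip: XY XY')
  have "\<theta>\<^sup>2 * inverse \<theta> = \<theta>"
    using pos by (simp add: power2_eq_square)
  then have "0 < of_int X * (\<theta>\<^sup>2 - 1)"
    using less' by (simp add: distrib_left mult.left_commute[of "\<theta>\<^sup>2"]
        mult.commute[of "\<theta>\<^sup>2" "of_int X"] right_diff_distrib)
  moreover have "0 < \<theta>\<^sup>2 - 1"
    using gt_1 by simp
  ultimately have "0 \<le> X"
    by (simp add: zero_less_mult_iff)
  have "\<alpha> = \<beta> * \<theta> powi i"
    using pos by (simp add: \<beta>_def power_int_minus)
  also have "\<dots> = of_int X * \<theta> powi i + of_int Y * \<theta> powi (i + 1)"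
    using powi_add[of i 1] by (simp add: XY algebra_simps)
  also have "\<dots> = (\<Sum>j\<in>#replicate_mset (nat X) i + replicate_mset (nat Y) (i + 1). \<theta> powi j)"
    using \<open>0 \<le> X\<close> \<open>0 \<le> Y\<close> by simp
  finally show ?thesis
    by blast
qed

text \<open>Telescopes: \<open>(a - 2) * \<theta> powi j\<close> is the difference of the
  consecutive gaps \<open>\<theta> powi (j + 1) - \<theta> powi j\<close> and
  \<open>\<theta> powi j - \<theta> powi (j - 1)\<close>. Raising both end digits by one then leaves
  only the two powers just outside the word.\<close>

lemma sum_powi_word:
  "(\<Sum>j=i - int n..i. of_int (a - 2) * \<theta> powi j) =
     \<theta> powi (i + 1) - \<theta> powi i - \<theta> powi (i - int n) + \<theta> powi (i - int n - 1)"
proof (induction n)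
  case 0
  then show ?case
    using powi_recurrence[of i] by (simp add: algebra_simps)
next
  case (Suc n)
  have "{i - int (Suc n)..i} = insert (i - int n - 1) {i - int n..i}"
    by auto
  then show ?case
    using Suc powi_recurrence[of "i - int n - 1"] by (simp add: algebra_simps)
qed

text \<open>A forbidden word may be replaced by two single powers; for \<open>n = 0\<close> this is the carry
  \<open>a \<theta>\<^sup>i = \<theta>\<^bsup>i+1\<^esup> + \<theta>\<^bsup>i-1\<^esup>\<close>. Both shrink the digit sum.\<close>

lemma forbidden_word_shrink:
  fixes A :: "int multiset"
  assumes "\<And>j. j \<in> {i - int n..i} \<Longrightarrow>
    nat (a - 2) + of_bool (j = i) + of_bool (j = i - int n) \<le> count A j"
  shows "\<exists>B. size B < size A \<and> (\<Sum>j\<in>#B. \<theta> powi j) = (\<Sum>j\<in>#A. \<theta> powi j)"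
proof -
  \<comment> \<open>The forbidden word as a multiset of exponents. For \<open>n = 0\<close> both
    extra units fall on \<open>i\<close>, which then occurs \<open>a\<close> times.\<close>
  define W where "W = (\<Sum>j\<in>{i - int n..i}. replicate_mset (nat (a - 2)) j) + {#i, i - int n#}"
  define B where "B = A - W + {#i + 1, i - int n - 1#}"
  have count_W: "count W j = (if j \<in> {i - int n..i} then nat (a - 2) else 0)
      + of_bool (j = i) + of_bool (j = i - int n)" for j
    by (auto simp: W_def count_sum)
  have "W \<subseteq># A"
  proof (rule mset_subset_eqI)
    show "count W j \<le> count A j" for j
      using assms[of j] unfolding count_W by (cases "j \<in> {i - int n..i}") auto
  qed
  then have A: "A = (A - W) + W"
    by simp
  have "nat (int n + 1) = n + 1"
    by simp
  then have "size W = (n + 1) * nat (a - 2) + 2"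
    by (simp add: W_def)
  \<comment> \<open>This is where \<open>a \<ge> 3\<close> makes the exchange a strict gain: more
    than two powers are removed and two are added.\<close>
  moreover have "1 \<le> nat (a - 2)"
    using a_ge by simp
  ultimately have "2 < size W"
    using a_ge by simp
  then have "size B < size A"
    using arg_cong[OF A, of size] by (simp add: B_def)
  moreover have "(\<Sum>j\<in>#W. \<theta> powi j) = (\<Sum>j\<in>{i - int n..i}. of_int (a - 2) * \<theta> powi j)
      + \<theta> powi i + \<theta> powi (i - int n)"
  proof -
    have "(\<Sum>j\<in>#(\<Sum>j\<in>I. replicate_mset (nat (a - 2)) j). \<theta> powi j)
        = (\<Sum>j\<in>I. of_int (a - 2) * \<theta> powi j)" if "finite I" for I
      using that a_ge by (induction I) simp_all
    then show ?thesis
      unfolding W_def by simp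
  qed
  then have "(\<Sum>j\<in>#W. \<theta> powi j) = \<theta> powi (i + 1) + \<theta> powi (i - int n - 1)"
    unfolding sum_powi_word by simp
  then have "(\<Sum>j\<in>#B. \<theta> powi j) = (\<Sum>j\<in>#A. \<theta> powi j)"
    unfolding B_def by (subst (2) A) simp
  ultimately show ?thesis
    by blast
qed

lemma sum_mset_powi_eq:
  assumes "finite I" "set_mset A \<subseteq> I"
  shows "(\<Sum>j\<in>#A. \<theta> powi j) = (\<Sum>j\<in>I. of_int (int (count A j)) * \<theta> powi j)"
  using assms(2)
proof (induction A)
  case (add x A)
  have "(\<Sum>j\<in>I. of_int (int (count (add_mset x A) j)) * \<theta> powi j)
      = (\<Sum>j\<in>I. of_int (int (count A j)) * \<theta> powi j + (if j = x then \<theta> powi j else 0))"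
    by (rule sum.cong) (simp_all add: algebra_simps)
  also have "\<dots> = (\<Sum>j\<in>I. of_int (int (count A j)) * \<theta> powi j) + \<theta> powi x"
    using assms(1) add.prems by (simp add: sum.distrib)
  finally show ?case
    using add by simp
qed simp

text \<open>The digits are the multiplicities in a multiset of exponents of least size with sum
  \<alpha>; by minimality no exchange that shrinks it is possible.\<close>

lemma greedy_expansion_exists:
  assumes "\<alpha> \<in> Z_adjoin \<theta>" "0 < \<alpha>" "0 < cj \<alpha>"
  shows "\<exists>m M b. greedy_digits a m M b \<and> b m \<noteq> 0 \<and> \<alpha> = (\<Sum>i=m..M. of_int (b i) * \<theta> powi i)"
proof -
  obtain A where A: "\<alpha> = (\<Sum>i\<in>#A. \<theta> powi i)"
    and min: "\<And>B. \<alpha> = (\<Sum>i\<in>#B. \<theta> powi i) \<Longrightarrow> size A \<le> size B"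
    using ex_has_least_nat[of "\<lambda>A. \<alpha> = (\<Sum>i\<in>#A. \<theta> powi i)" _ size]
      totally_positive_imp_sum_powers[OF assms] by metis
  have no_word: "\<exists>j\<in>{i - int n..i}.
      count A j < nat (a - 2) + of_bool (j = i) + of_bool (j = i - int n)" for i n
    using forbidden_word_shrink[of i n A] min A by (metis not_le)
  define m where "m = Min (set_mset A)"
  define M where "M = Max (set_mset A)"
  define b where "b i = int (count A i)" for i
  have "A \<noteq> {#}"
    using A assms by auto
  then have "m \<in># A" "m \<le> M"
    by (auto simp: m_def M_def)
  have "set_mset A \<subseteq> {m..M}"
    by (auto simp: m_def M_def)
  then have sum: "\<alpha> = (\<Sum>i=m..M. of_int (b i) * \<theta> powi i)"
    unfolding A b_def by (intro sum_mset_powi_eq) simp_all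
  \<comment> \<open>The digit bound is the case of a word of length one, that is, of no possible
    carry.\<close>
  have digit: "b i \<in> {0..a - 1}" for i
    using no_word[of i 0] a_ge by (auto simp: b_def)
  have "\<not> (1 \<le> k \<and> b i = a - 1 \<and> b (i - k) = a - 1 \<and> (\<forall>j\<in>{i - k<..<i}. b j = a - 2))" for i k
  proof
    assume *: "1 \<le> k \<and> b i = a - 1 \<and> b (i - k) = a - 1 \<and> (\<forall>j\<in>{i - k<..<i}. b j = a - 2)"
    obtain j where j: "j \<in> {i - k..i}"
      and less: "count A j < nat (a - 2) + of_bool (j = i) + of_bool (j = i - k)"
      using no_word[of i "nat k"] * by auto
    \<comment> \<open>Minimality gives a position where the count falls short of the word. But each
      position meets it exactly: \<open>a - 1\<close> at the ends, which are distinct since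
      \<open>k \<ge> 1\<close>, and \<open>a - 2\<close> in between.\<close>
    consider "j = i" | "j = i - k" | "j \<in> {i - k<..<i}"
      using j by fastforce
    then show False
    proof cases
      case 1
      then have "int (count A j) = a - 1" using * by (simp add: b_def)
      then show ?thesis using less 1 * a_ge by auto
    next
      case 2
      then have "int (count A j) = a - 1" using * by (simp add: b_def)
      then show ?thesis using less 2 * a_ge by auto
    next
      case 3
      then have "int (count A j) = a - 2" using * by (simp add: b_def)
      then show ?thesis using less 3 a_ge by auto
    qed
  qed
  then have "greedy_digits a m M b"
    unfolding greedy_digits_def using \<open>m \<le> M\<close> digit by blast
  moreover have "b m \<noteq> 0"
    using \<open>m \<in># A\<close> by (simp add: b_def)
  ultimately show ?thesis
    using sum by blast
qed

section \<open>The size of the conjugate of a greedy polynomial\<close>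

text \<open>After a digit \<open>a-1\<close> the remaining tail cannot start with a word \<open>(a-2)\<dots>(a-2)(a-1)\<close>; the
  sharper bound for such tails is what makes the induction work.\<close>

lemma greedy_tail_bound:
  assumes "\<And>i. i \<in> {m..M} \<Longrightarrow> b i \<in> {0..a - 1}"
    and "\<And>i k. 1 \<le> k \<Longrightarrow> m \<le> i - k \<Longrightarrow> i \<le> M \<Longrightarrow> b i = a - 1 \<Longrightarrow> b (i - k) = a - 1 \<Longrightarrow>
        \<forall>j\<in>{i - k<..<i}. b j = a - 2 \<Longrightarrow> False"
  shows "(\<Sum>i=m..M. of_int (b i) * \<theta> powi (- i)) < \<theta> powi (1 - m) \<and>
    ((\<forall>i\<in>{m..M}. b i = a - 1 \<longrightarrow> (\<exists>j\<in>{m..<i}. b j \<noteq> a - 2)) \<longrightarrow>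
      (\<Sum>i=m..M. of_int (b i) * \<theta> powi (- i)) < \<theta> powi (1 - m) - \<theta> powi (- m))"
  using assms
\<comment> \<open>The lowest exponent is peeled off because its term has the largest power of
  \<theta> after conjugation; \<open>M\<close> stays fixed.\<close>
proof (induction "nat (M + 1 - m)" arbitrary: m)
  case 0
  have "\<theta> powi (1 - m) = \<theta> * \<theta> powi (- m)"
    using powi_add[of 1 "- m"] by simp
  then have "\<theta> powi (- m) < \<theta> powi (1 - m)"
    using gt_1 powi_pos[of "- m"] by simp
  then show ?case
    using 0(1) by simp
next
  case (Suc n)
  define x where "x = \<theta> powi (- m)"
  define S where "S = (\<Sum>i=m + 1..M. of_int (b i) * \<theta> powi (- i))"
  have "m \<le> M"
    using Suc(2) by simp
  have x: "0 < x" "\<theta> powi (1 - m) = \<theta> * x" "\<theta> powi (1 - (m + 1)) = x"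
    "\<theta> powi (- (m + 1)) = inverse \<theta> * x"
    using powi_add[of 1 "- m"] powi_add[of "- 1" "- m"]
    by (simp_all add: x_def power_int_minus algebra_simps)
  have IH: "S < x" "(\<forall>i\<in>{m+1..M}. b i = a - 1 \<longrightarrow> (\<exists>j\<in>{m+1..<i}. b j \<noteq> a - 2)) \<Longrightarrow> S < x - inverse \<theta> * x"
  proof -
    have *: "n = nat (M + 1 - (m + 1))" "\<And>i. i \<in> {m + 1..M} \<Longrightarrow> b i \<in> {0..a - 1}"
      using Suc.hyps(2) Suc.prems(1) by auto
    have "1 \<le> k \<Longrightarrow> m + 1 \<le> i - k \<Longrightarrow> i \<le> M \<Longrightarrow> b i = a - 1 \<Longrightarrow> b (i - k) = a - 1 \<Longrightarrow>
        \<forall>j\<in>{i - k<..<i}. b j = a - 2 \<Longrightarrow> False" for i k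
      using Suc.prems(2)[of k i] by linarith
    note no_word = this
    have "S < \<theta> powi (1 - (m + 1)) \<and>
      ((\<forall>i\<in>{m+1..M}. b i = a - 1 \<longrightarrow> (\<exists>j\<in>{m+1..<i}. b j \<noteq> a - 2)) \<longrightarrow>
        S < \<theta> powi (1 - (m + 1)) - \<theta> powi (- (m + 1)))"
      unfolding S_def by (rule Suc.hyps(1)[OF *(1)]) (fact *(2), fact no_word)
    then show "S < x" "(\<forall>i\<in>{m+1..M}. b i = a - 1 \<longrightarrow> (\<exists>j\<in>{m+1..<i}. b j \<noteq> a - 2)) \<Longrightarrow>
        S < x - inverse \<theta> * x"
      unfolding x by blast+
  qed
  have "{m..M} = insert m {m + 1..M}"
    using \<open>m \<le> M\<close> by auto
  then have sum: "(\<Sum>i=m..M. of_int (b i) * \<theta> powi (- i)) = of_int (b m) * x + S"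
    by (simp add: S_def x_def)
  have bm: "b m \<in> {0..a - 1}"
    using Suc.prems(1) \<open>m \<le> M\<close> by simp
  \<comment> \<open>In both bounds the largest admissible digit (\<open>a - 1\<close>, respectively
    \<open>a - 2\<close>) together with the sharp tail bound \<open>x - inverse \<theta> * x\<close>
    meets the limit exactly, by this identity. Smaller digits leave room for the weaker tail bound
    \<open>S < x\<close>.\<close>
  have ax: "of_int a * x = \<theta> * x + inverse \<theta> * x"
    by (simp add: inverse_eq algebra_simps)
  have small: "0 < inverse \<theta> * x" "inverse \<theta> * x < x"
    using x(1) gt_1 inverse_less_1_iff[of \<theta>] pos by simp_all
  have mono: "of_int (b m) * x \<le> of_int c * x" if "b m \<le> c" for c
    using that x(1) by simp
  have "of_int (b m) * x + S < \<theta> * x"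
  proof (cases "b m = a - 1")
    case True
    have "\<exists>j\<in>{m+1..<i}. b j \<noteq> a - 2" if "i \<in> {m+1..M}" "b i = a - 1" for i
      using Suc.prems(2)[of "i - m" i] that True by force
    then have "S < x - inverse \<theta> * x"
      using IH(2) by blast
    moreover have "of_int (b m) * x = of_int a * x - x"
      by (simp add: True left_diff_distrib)
    ultimately show ?thesis
      using ax by linarith
  next
    case False
    then show ?thesis
      using mono[of "a - 2"] bm IH(1) ax small by (simp add: algebra_simps)
  qed
  moreover have "of_int (b m) * x + S < \<theta> * x - x"
    if start: "\<forall>i\<in>{m..M}. b i = a - 1 \<longrightarrow> (\<exists>j\<in>{m..<i}. b j \<noteq> a - 2)"
  proof (cases "b m = a - 2")
    case True
    have "\<exists>j\<in>{m+1..<i}. b j \<noteq> a - 2" if i: "i \<in> {m+1..M}" "b i = a - 1" for i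
    proof -
      obtain j where j: "j \<in> {m..<i}" "b j \<noteq> a - 2"
        using start i by force
      then have "j \<noteq> m"
        using True by auto
      then show ?thesis
        using j by (intro bexI[of _ j]) auto
    qed
    then have "S < x - inverse \<theta> * x"
      using IH(2) by blast
    moreover have "of_int (b m) * x = of_int a * x - 2 * x"
      by (simp add: True left_diff_distrib)
    ultimately show ?thesis
      using ax by linarith
  next
    case False
    \<comment> \<open>At \<open>i = m\<close> the range \<open>{m..<i}\<close> is empty, so
      \<open>start\<close> excludes this digit.\<close>
    moreover have "b m \<noteq> a - 1"
      using start \<open>m \<le> M\<close> by force
    ultimately show ?thesis
      using mono[of "a - 3"] bm IH(1) ax small by (simp add: algebra_simps)
  qed
  ultimately show ?case
    unfolding sum x x_def[symmetric] by blast
qed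

text \<open>The lower bound is the single term at \<open>m\<close>. Since the upper bound is strict,
  the windows belonging to different \<open>m\<close> are disjoint.\<close>

lemma greedy_conj_bounds:
  assumes "greedy_digits a m M b" "b m \<noteq> 0"
  shows "\<theta> powi (- m) \<le> (\<Sum>i=m..M. of_int (b i) * \<theta> powi (- i))"
    and "(\<Sum>i=m..M. of_int (b i) * \<theta> powi (- i)) < \<theta> powi (1 - m)"
proof -
  have digit: "b i \<in> {0..a - 1}" if "i \<in> {m..M}" for i
    using assms that by (auto simp: greedy_digits_def)
  have "m \<le> M"
    using assms by (auto simp: greedy_digits_def)
  then have "1 \<le> b m"
    using assms(2) digit[of m] by simp
  then have "\<theta> powi (- m) \<le> of_int (b m) * \<theta> powi (- m)"
    by simp
  also have "\<dots> \<le> (\<Sum>i=m..M. of_int (b i) * \<theta> powi (- i))"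
    using digit \<open>m \<le> M\<close> pos by (intro member_le_sum) auto
  finally show "\<theta> powi (- m) \<le> (\<Sum>i=m..M. of_int (b i) * \<theta> powi (- i))" .
  have "1 \<le> k \<Longrightarrow> m \<le> i - k \<Longrightarrow> i \<le> M \<Longrightarrow> b i = a - 1 \<Longrightarrow> b (i - k) = a - 1 \<Longrightarrow>
        \<forall>j\<in>{i - k<..<i}. b j = a - 2 \<Longrightarrow> False" for i k
    using assms(1) unfolding greedy_digits_def by blast
  then show "(\<Sum>i=m..M. of_int (b i) * \<theta> powi (- i)) < \<theta> powi (1 - m)"
    using greedy_tail_bound[of m M b] digit by blast
qed

text \<open>Existence of greedy expansions and disjointness of the windows resolve the definite
  description; the factor \<theta> is the width of a window.\<close>

lemma theta_abs0_bounds: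
  assumes "\<alpha> \<in> Z_adjoin \<theta>" "\<alpha> \<noteq> 0" "sgn \<alpha> = sgn (cj \<alpha>)"
  shows "theta_abs0 a \<theta> \<alpha> \<in> range (\<lambda>k. \<theta> powi k)"
    and "theta_abs0 a \<theta> \<alpha> \<le> \<bar>cj \<alpha>\<bar>" and "\<bar>cj \<alpha>\<bar> \<le> \<theta> * theta_abs0 a \<theta> \<alpha>"
proof -
  define P where "P m \<longleftrightarrow> (\<exists>M b s. greedy_digits a m M b \<and> b m \<noteq> 0 \<and> s \<in> {1, -1} \<and>
    \<alpha> = s * (\<Sum>i=m..M. of_int (b i) * \<theta> powi i))" for m
  have bounds: "\<theta> powi (- m) \<le> \<bar>cj \<alpha>\<bar> \<and> \<bar>cj \<alpha>\<bar> < \<theta> powi (1 - m)" if P: "P m" for m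
  proof -
    obtain M b s where *: "greedy_digits a m M b" "b m \<noteq> 0" "s \<in> {1, -1}"
      and \<alpha>: "\<alpha> = s * (\<Sum>i=m..M. of_int (b i) * \<theta> powi i)"
      using P unfolding P_def by blast
    have "\<bar>cj \<alpha>\<bar> = \<bar>\<Sum>i=m..M. of_int (b i) * \<theta> powi (- i)\<bar>"
      using sum_conj[of b "{m..M}"] Z_adjoin_subset conj_uminus *(3) unfolding \<alpha> by auto
    also have "\<dots> = (\<Sum>i=m..M. of_int (b i) * \<theta> powi (- i))"
      using greedy_conj_bounds(1)[OF *(1,2)] powi_pos[of "- m"] by (intro abs_of_pos) linarith
    finally show ?thesis
      using greedy_conj_bounds[OF *(1,2)] by simp
  qed
  have "\<exists>m. P m"
  proof -
    \<comment> \<open>A totally negative element is expanded through its negative, in accordance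
      with the sign allowed in \<open>theta_abs0\<close>.\<close>
    define s where "s = sgn \<alpha>"
    have s: "s \<in> {1, -1}" "s * s = 1"
      using assms(2) by (auto simp: s_def sgn_if)
    have "s * \<alpha> \<in> Z_adjoin \<theta>" "0 < s * \<alpha>" "cj (s * \<alpha>) = s * cj \<alpha>"
      using assms s Z_adjoin_subset Z_adjoin_uminus conj_uminus
      by (auto simp: s_def sgn_if split: if_splits)
    moreover have "0 < s * cj \<alpha>"
      using assms by (auto simp: s_def sgn_if split: if_splits)
    ultimately obtain m M b where *: "greedy_digits a m M b" "b m \<noteq> 0"
      "s * \<alpha> = (\<Sum>i=m..M. of_int (b i) * \<theta> powi i)"
      using greedy_expansion_exists[of "s * \<alpha>"] by auto
    have "\<alpha> = s * (s * \<alpha>)"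
      using s(2) by (simp flip: mult.assoc)
    then show ?thesis
      unfolding P_def *(3) using *(1,2) s(1) by blast
  qed
  then obtain m where m: "P m" by blast
  \<comment> \<open>The windows of \<open>n\<close> and \<open>m\<close> share the point
    \<open>\<bar>cj \<alpha>\<bar>\<close>, so they coincide.\<close>
  have "n = m" if "P n" for n
  proof -
    have "\<theta> powi (- m) < \<theta> powi (1 - n)" "\<theta> powi (- n) < \<theta> powi (1 - m)"
      using bounds[OF m] bounds[OF that] by linarith+
    then have "- m < 1 - n" "- n < 1 - m"
      using gt_1 power_int_increasing[of "1 - n" "- m" \<theta>] power_int_increasing[of "1 - m" "- n" \<theta>]
      by (smt (verit))+
    then show ?thesis by simp
  qed
  then have "(THE m. P m) = m"
    using m by (intro the_equality)
  then have eq: "theta_abs0 a \<theta> \<alpha> = \<theta> powi (- m)"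
    using assms(2) unfolding theta_abs0_def P_def by simp
  then show "theta_abs0 a \<theta> \<alpha> \<in> range (\<lambda>k. \<theta> powi k)" "theta_abs0 a \<theta> \<alpha> \<le> \<bar>cj \<alpha>\<bar>"
    using bounds[OF m] by auto
  show "\<bar>cj \<alpha>\<bar> \<le> \<theta> * theta_abs0 a \<theta> \<alpha>"
    using bounds[OF m] powi_add[of 1 "- m"] by (simp add: eq)
qed

end

subsection \<open>Real numbers and limits\<close>

text \<open>The reals as a ring record, to serve as target of the first isomorphism theorem.\<close>

definition real_ring :: "real ring" where
  "real_ring = \<lparr>carrier = UNIV, mult = (*), one = 1, zero = 0, add = (+)\<rparr>"

lemma real_ring_simps [simp]:
  "carrier real_ring = UNIV" "mult real_ring = (*)" "one real_ring = 1"
  "zero real_ring = 0" "add real_ring = (+)"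
  by (simp_all add: real_ring_def)

lemma field_real_ring: "field real_ring"
proof (rule cring.cring_fieldI2)
  show "cring real_ring"
  proof (intro cringI abelian_groupI comm_monoidI)
    show "\<exists>y\<in>carrier real_ring. y \<oplus>\<^bsub>real_ring\<^esub> x = \<zero>\<^bsub>real_ring\<^esub>" for x
      by (auto intro!: exI[of _ "- x"])
  qed (auto simp: algebra_simps)
  show "\<exists>b\<in>carrier real_ring. x \<otimes>\<^bsub>real_ring\<^esub> b = \<one>\<^bsub>real_ring\<^esub>" if "x \<noteq> \<zero>\<^bsub>real_ring\<^esub>" for x
    using that by (auto intro!: exI[of _ "inverse x"])
qed simp

text \<open>The limsup is the limit of a subsequence, and a finite set is closed.\<close>

lemma limsup_mem_finite:
  fixes u :: "nat \<Rightarrow> 'a :: {complete_linorder, linorder_topology}"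
  assumes "finite F" "eventually (\<lambda>n. u n \<in> F) sequentially"
  shows "limsup u \<in> F"
proof -
  obtain r where r: "strict_mono r" "(u \<circ> r) \<longlonglongrightarrow> limsup u"
    using limsup_subseq_lim by blast
  have "eventually (\<lambda>n. (u \<circ> r) n \<in> F) sequentially"
    using eventually_subseq[OF r(1) assms(2)] by simp
  then show ?thesis
    using Lim_in_closed_set[OF finite_imp_closed[OF assms(1)] _ _ r(2)] by simp
qed

text \<open>Integer powers accumulate only at 0 and at infinity, and the bounds \<open>l > 0\<close>
  and \<open>h\<close> keep away from both.\<close>

lemma finite_powi_between:
  fixes x :: real
  assumes "1 < x" "0 < l"
  shows "finite {y \<in> range (\<lambda>k. x powi k). l \<le> y \<and> y \<le> h}"
proof -
  obtain m where m: "h < x ^ m"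
    using real_arch_pow[OF assms(1)] by blast
  obtain n where "inverse l < x ^ n"
    using real_arch_pow[OF assms(1)] by blast
  then have n: "inverse (x ^ n) < l"
    using assms by (simp add: field_simps)
  have "{y \<in> range (\<lambda>k. x powi k). l \<le> y \<and> y \<le> h} \<subseteq> (\<lambda>k. x powi k) ` {- int n..int m}"
  proof clarify
    fix k assume k: "l \<le> x powi k" "x powi k \<le> h"
    have "x powi (- int n) < x powi k" "x powi k < x powi int m"
      using k m n by (simp_all add: power_int_minus)
    then have "- int n \<le> k" "k \<le> int m"
      using assms(1) power_int_increasing[of k "- int n" x] power_int_increasing[of "int m" k x]
      by (smt (verit))+
    then show "x powi k \<in> (\<lambda>k. x powi k) ` {- int n..int m}"
      by auto
  qed
  then show ?thesis
    by (rule finite_subset) simp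
qed

locale maximal_quadratic_unit = quadratic_unit +
  assumes int_ring_eq: "int_ring \<theta> = Z_adjoin \<theta>"
begin

subsection \<open>Comparison with the conjugate absolute value\<close>

lemma int_ring_subset: "int_ring \<theta> \<subseteq> quad_field \<theta>"
  by (auto simp: int_ring_def)

lemma theta_abs_0 [simp]: "theta_abs a \<theta> 0 = 0"
  by (simp add: theta_abs_def theta_abs0_def)

text \<open>The window width \<theta> divided by \<open>1 - inverse \<theta>\<close>, the modulus of
  the conjugate of the multiplier \<open>\<theta> - 1\<close>.\<close>

definition ratio :: real where "ratio = \<theta>\<^sup>2 / (\<theta> - 1)"

lemma ratio_pos [simp]: "0 < ratio" and ratio_neq_0 [simp]: "ratio \<noteq> 0"
  using gt_1 by (simp_all add: ratio_def)

lemma theta_abs_bounds: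
  assumes "\<alpha> \<in> int_ring \<theta>"
  shows theta_abs_range: "\<alpha> \<noteq> 0 \<Longrightarrow> theta_abs a \<theta> \<alpha> \<in> range (\<lambda>k. \<theta> powi k)"
    and theta_abs_le: "theta_abs a \<theta> \<alpha> \<le> \<bar>cj \<alpha>\<bar>"
    and conj_le_theta_abs: "\<bar>cj \<alpha>\<bar> \<le> ratio * theta_abs a \<theta> \<alpha>"
  unfolding ratio_def
proof -
  have *: "theta_abs a \<theta> \<alpha> \<in> range (\<lambda>k. \<theta> powi k) \<and> theta_abs a \<theta> \<alpha> \<le> \<bar>cj \<alpha>\<bar> \<and>
      \<bar>cj \<alpha>\<bar> \<le> \<theta>\<^sup>2 / (\<theta> - 1) * theta_abs a \<theta> \<alpha>" if "\<alpha> \<noteq> 0"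
  proof (cases "sgn \<alpha> = sgn (cj \<alpha>)")
    case True
    have eq: "theta_abs a \<theta> \<alpha> = theta_abs0 a \<theta> \<alpha>"
      using True that by (simp add: theta_abs_def int_ring1_def)
    have bounds: "theta_abs0 a \<theta> \<alpha> \<in> range (\<lambda>k. \<theta> powi k)" "theta_abs0 a \<theta> \<alpha> \<le> \<bar>cj \<alpha>\<bar>"
      "\<bar>cj \<alpha>\<bar> \<le> \<theta> * theta_abs0 a \<theta> \<alpha>"
      using theta_abs0_bounds[of \<alpha>] assms that True by (simp_all add: int_ring_eq)
    \<comment> \<open>For equal signs the factor \<theta> suffices; it is enlarged to a constant
      common to both cases.\<close>
    have "\<theta> \<le> \<theta>\<^sup>2 / (\<theta> - 1)"
      using gt_1 by (simp add: field_simps power2_eq_square)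
    moreover have "0 \<le> theta_abs0 a \<theta> \<alpha>"
      using bounds(1) powi_pos by (auto simp: less_imp_le)
    ultimately have "\<theta> * theta_abs0 a \<theta> \<alpha> \<le> \<theta>\<^sup>2 / (\<theta> - 1) * theta_abs0 a \<theta> \<alpha>"
      by (rule mult_right_mono)
    then show ?thesis
      using bounds unfolding eq by linarith
  next
    case False
    have eq: "theta_abs a \<theta> \<alpha> = theta_abs0 a \<theta> ((\<theta> - 1) * \<alpha>)"
      using False assms by (simp add: theta_abs_def int_ring1_def)
    have \<alpha>: "\<alpha> \<in> Z_adjoin \<theta>" "\<alpha> \<in> quad_field \<theta>"
      using assms int_ring_eq int_ring_subset by auto
    have T: "\<theta> - 1 \<in> Z_adjoin \<theta>"
      by (intro Z_adjoin_diff) simp_all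
    have "cj (\<theta> - 1) = inverse \<theta> - 1"
      using conj_diff[OF subsetD[OF Z_adjoin_subset Z_adjoin_theta] subsetD[OF Z_adjoin_subset Z_adjoin_1]]
      by simp
    then have cj: "cj ((\<theta> - 1) * \<alpha>) = (inverse \<theta> - 1) * cj \<alpha>"
      using conj_mult[of "\<theta> - 1" \<alpha>] T \<alpha> Z_adjoin_subset by auto
    \<comment> \<open>The multiplier is positive with negative conjugate, so it turns opposite signs
      into equal ones.\<close>
    have neg: "inverse \<theta> - 1 < 0"
      using gt_1 inverse_less_1_iff[of \<theta>] by simp
    have "cj \<alpha> \<noteq> 0"
      using \<alpha> that by (simp add: conj_eq_0_iff)
    then have "sgn ((\<theta> - 1) * \<alpha>) = sgn (cj ((\<theta> - 1) * \<alpha>))"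
      using False that gt_1 neg unfolding cj by (simp add: sgn_mult) (auto simp: sgn_if split: if_splits)
    then have bounds: "theta_abs0 a \<theta> ((\<theta> - 1) * \<alpha>) \<in> range (\<lambda>k. \<theta> powi k)"
      "theta_abs0 a \<theta> ((\<theta> - 1) * \<alpha>) \<le> \<bar>(inverse \<theta> - 1) * cj \<alpha>\<bar>"
      "\<bar>(inverse \<theta> - 1) * cj \<alpha>\<bar> \<le> \<theta> * theta_abs0 a \<theta> ((\<theta> - 1) * \<alpha>)"
      using theta_abs0_bounds[of "(\<theta> - 1) * \<alpha>"] T \<alpha> that gt_1 Z_adjoin_mult by (auto simp: cj)
    have abs: "\<bar>(inverse \<theta> - 1) * cj \<alpha>\<bar> = (1 - inverse \<theta>) * \<bar>cj \<alpha>\<bar>"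
      using neg by (simp add: abs_mult)
    \<comment> \<open>The factor is below 1, which preserves the upper bound on the absolute value;
      undoing it costs \<open>\<theta> / (\<theta> - 1)\<close> in the other inequality.\<close>
    have "(1 - inverse \<theta>) * \<bar>cj \<alpha>\<bar> \<le> 1 * \<bar>cj \<alpha>\<bar>"
      using pos by (intro mult_right_mono) auto
    moreover have "\<bar>cj \<alpha>\<bar> = \<theta> / (\<theta> - 1) * ((1 - inverse \<theta>) * \<bar>cj \<alpha>\<bar>)"
      using gt_1 by (simp add: field_simps)
    moreover have "\<dots> \<le> \<theta> / (\<theta> - 1) * (\<theta> * theta_abs0 a \<theta> ((\<theta> - 1) * \<alpha>))"
      using bounds(3) gt_1 unfolding abs by (intro mult_left_mono) auto
    ultimately show ?thesis
      using bounds(1,2) unfolding eq abs by (simp add: power2_eq_square)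
  qed
  then show "\<alpha> \<noteq> 0 \<Longrightarrow> theta_abs a \<theta> \<alpha> \<in> range (\<lambda>k. \<theta> powi k)"
    by blast
  show "theta_abs a \<theta> \<alpha> \<le> \<bar>cj \<alpha>\<bar>" "\<bar>cj \<alpha>\<bar> \<le> \<theta>\<^sup>2 / (\<theta> - 1) * theta_abs a \<theta> \<alpha>"
    using * by (cases "\<alpha> = 0"; simp)+
qed

lemma theta_abs_nonneg: "\<alpha> \<in> int_ring \<theta> \<Longrightarrow> 0 \<le> theta_abs a \<theta> \<alpha>"
  using conj_le_theta_abs[of \<alpha>] ratio_pos
  by (metis abs_ge_zero order.trans zero_le_mult_iff not_le order.asym)

subsection \<open>The completion is isomorphic to the reals\<close>

lemma int_ring_diff: "x \<in> int_ring \<theta> \<Longrightarrow> y \<in> int_ring \<theta> \<Longrightarrow> x - y \<in> int_ring \<theta>"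
  unfolding int_ring_eq by (rule Z_adjoin_diff)

text \<open>The two-sided comparison is applied to differences. It makes the completeness of the
  reals available for conjugate sequences.\<close>

lemma theta_Cauchy_iff:
  assumes "range f \<subseteq> int_ring \<theta>"
  shows "theta_Cauchy a \<theta> f \<longleftrightarrow> Cauchy (\<lambda>n. cj (f n))"
proof -
  have f: "f n \<in> int_ring \<theta>" for n
    using assms by blast
  have diff: "cj (f i) - cj (f j) = cj (f i - f j)" for i j
    using f int_ring_subset by (intro conj_diff[symmetric]) auto
  show ?thesis
  proof
    assume L: "theta_Cauchy a \<theta> f"
    show "Cauchy (\<lambda>n. cj (f n))"
    proof (rule CauchyI)
      fix e :: real assume "0 < e"
      then obtain N where N: "theta_abs a \<theta> (f i - f j) < e / ratio" if "N \<le> i" "N \<le> j" for i j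
        using L unfolding theta_Cauchy_def by (meson divide_pos_pos ratio_pos)
      have "norm (cj (f i) - cj (f j)) < e" if "N \<le> i" "N \<le> j" for i j
      proof -
        have "\<bar>cj (f i - f j)\<bar> \<le> ratio * theta_abs a \<theta> (f i - f j)"
          by (intro conj_le_theta_abs int_ring_diff f)
        also have "\<dots> < e"
          using N[OF that] by (simp add: field_simps)
        finally show ?thesis
          by (simp add: diff)
      qed
      then show "\<exists>M. \<forall>m\<ge>M. \<forall>n\<ge>M. norm (cj (f m) - cj (f n)) < e"
        by blast
    qed
  next
    assume R: "Cauchy (\<lambda>n. cj (f n))"
    show "theta_Cauchy a \<theta> f"
      unfolding theta_Cauchy_def
    proof (intro allI impI)
      fix e :: real assume "0 < e"
      then obtain N where "norm (cj (f i) - cj (f j)) < e" if "N \<le> i" "N \<le> j" for i j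
        using CauchyD[OF R] by blast
      then have "theta_abs a \<theta> (f i - f j) < e" if "N \<le> i" "N \<le> j" for i j
        using theta_abs_le[OF int_ring_diff[OF f f], of i j] that unfolding diff
        by (metis order.strict_trans1 real_norm_def)
      then show "\<exists>N. \<forall>i\<ge>N. \<forall>j\<ge>N. theta_abs a \<theta> (f i - f j) < e"
        by blast
    qed
  qed
qed

abbreviation R :: "(nat \<Rightarrow> real) ring" where
  "R \<equiv> Cauchy_ring a \<theta>"

lemma carrier_Cauchy_ring:
  "carrier R = {f. range f \<subseteq> int_ring \<theta> \<and> convergent (\<lambda>n. cj (f n))}"
  unfolding Cauchy_ring_def using theta_Cauchy_iff by (auto simp: Cauchy_convergent_iff)

lemma Cauchy_ring_simps [simp]:
  "mult R = (\<lambda>f g n. f n * g n)" "one R = (\<lambda>n. 1)" "zero R = (\<lambda>n. 0)"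
  "add R = (\<lambda>f g n. f n + g n)"
  by (simp_all add: Cauchy_ring_def)

definition conj_lim :: "(nat \<Rightarrow> real) \<Rightarrow> real" where
  "conj_lim f = lim (\<lambda>n. cj (f n))"

lemma carrierD:
  assumes "f \<in> carrier R"
  shows "f n \<in> int_ring \<theta>" "f n \<in> quad_field \<theta>" "(\<lambda>n. cj (f n)) \<longlonglongrightarrow> conj_lim f"
  using assms int_ring_subset unfolding carrier_Cauchy_ring conj_lim_def
  by (auto simp: convergent_LIMSEQ_iff)

lemma carrierI:
  assumes "\<And>n. f n \<in> int_ring \<theta>" "(\<lambda>n. cj (f n)) \<longlonglongrightarrow> r"
  shows "f \<in> carrier R \<and> conj_lim f = r"
  using assms limI[OF assms(2)] unfolding carrier_Cauchy_ring conj_lim_def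
  by (auto simp: convergent_def)

lemma const_carrier:
  assumes "\<alpha> \<in> int_ring \<theta>"
  shows "(\<lambda>n. \<alpha>) \<in> carrier R \<and> conj_lim (\<lambda>n. \<alpha>) = cj \<alpha>"
  using assms by (intro carrierI) simp_all

lemma add_carrier:
  assumes "f \<in> carrier R" "g \<in> carrier R"
  shows "(\<lambda>n. f n + g n) \<in> carrier R \<and> conj_lim (\<lambda>n. f n + g n) = conj_lim f + conj_lim g"
proof (rule carrierI)
  show "(\<lambda>n. cj (f n + g n)) \<longlonglongrightarrow> conj_lim f + conj_lim g"
    using tendsto_add[OF carrierD(3)[OF assms(1)] carrierD(3)[OF assms(2)]] assms
    by (simp add: conj_add carrierD)
  show "f n + g n \<in> int_ring \<theta>" for n
    using carrierD(1)[OF assms(1), of n] carrierD(1)[OF assms(2), of n]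
    unfolding int_ring_eq by (rule Z_adjoin_add)
qed

lemma mult_carrier:
  assumes "f \<in> carrier R" "g \<in> carrier R"
  shows "(\<lambda>n. f n * g n) \<in> carrier R \<and> conj_lim (\<lambda>n. f n * g n) = conj_lim f * conj_lim g"
proof (rule carrierI)
  show "(\<lambda>n. cj (f n * g n)) \<longlonglongrightarrow> conj_lim f * conj_lim g"
    using tendsto_mult[OF carrierD(3)[OF assms(1)] carrierD(3)[OF assms(2)]] assms
    by (simp add: conj_mult carrierD)
  show "f n * g n \<in> int_ring \<theta>" for n
    using carrierD(1)[OF assms(1), of n] carrierD(1)[OF assms(2), of n]
    unfolding int_ring_eq by (rule Z_adjoin_mult)
qed

lemma uminus_carrier:
  assumes "f \<in> carrier R"
  shows "(\<lambda>n. - f n) \<in> carrier R"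
  using const_carrier[of "-1"] mult_carrier[OF _ assms, of "\<lambda>n. -1"] Z_adjoin_of_int[of "-1"]
  by (simp add: int_ring_eq)

lemma cring_Cauchy_ring: "cring R"
proof (intro cringI abelian_groupI comm_monoidI)
  show "\<exists>g\<in>carrier R. g \<oplus>\<^bsub>R\<^esub> f = \<zero>\<^bsub>R\<^esub>" if "f \<in> carrier R" for f
    by (rule bexI[OF _ uminus_carrier[OF that]]) simp
  show "\<zero>\<^bsub>R\<^esub> \<in> carrier R" "\<one>\<^bsub>R\<^esub> \<in> carrier R"
    using const_carrier[of 0] const_carrier[of 1] by (simp_all add: int_ring_eq)
qed (auto simp: add_carrier mult_carrier algebra_simps)

sublocale lim_hom: ring_hom_ring R real_ring conj_lim
proof (rule ring_hom_ringI2)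
  show "ring R" "ring real_ring"
    using cring_Cauchy_ring field_real_ring by (auto simp: cring_def field_def domain_def)
  show "conj_lim \<in> ring_hom R real_ring"
    using const_carrier[of 1] by (auto intro!: ring_hom_memI simp: add_carrier mult_carrier int_ring_eq)
qed

text \<open>Both inequalities are used, one per direction. This identifies the quotient defining the
  completion with the quotient by a kernel.\<close>

lemma kernel_conj_lim: "a_kernel R real_ring conj_lim = null_ideal a \<theta>"
proof -
  have "conj_lim f = 0 \<longleftrightarrow> (\<lambda>n. theta_abs a \<theta> (f n)) \<longlonglongrightarrow> 0" if f: "f \<in> carrier R" for f
  proof
    assume "conj_lim f = 0"
    then have *: "(\<lambda>n. \<bar>cj (f n)\<bar>) \<longlonglongrightarrow> 0"
      using carrierD(3)[OF f] by (simp add: tendsto_rabs_zero)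
    show "(\<lambda>n. theta_abs a \<theta> (f n)) \<longlonglongrightarrow> 0"
      by (rule Lim_null_comparison[OF _ *])
        (simp add: theta_abs_le theta_abs_nonneg carrierD[OF f])
  next
    assume "(\<lambda>n. theta_abs a \<theta> (f n)) \<longlonglongrightarrow> 0"
    then have *: "(\<lambda>n. ratio * theta_abs a \<theta> (f n)) \<longlonglongrightarrow> 0"
      by (rule tendsto_mult_right_zero)
    have "(\<lambda>n. cj (f n)) \<longlonglongrightarrow> 0"
      by (rule Lim_null_comparison[OF _ *]) (simp add: conj_le_theta_abs carrierD[OF f])
    then show "conj_lim f = 0"
      using carrierD(3)[OF f] LIMSEQ_unique by blast
  qed
  then show ?thesis
    unfolding a_kernel_def' null_ideal_def real_ring_simps by blast
qed

lemma conj_lim_surj: "conj_lim ` carrier R = UNIV"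
proof -
  have "r \<in> conj_lim ` carrier R" for r
  proof -
    \<comment> \<open>The conjugate of \<open>f n\<close> is \<open>r * \<theta> ^ n\<close> rounded
      down and divided by \<open>\<theta> ^ n\<close>, hence within
      \<open>inverse \<theta> ^ n\<close> of \<open>r\<close>.\<close>
    define f where "f n = of_int \<lfloor>r * \<theta> ^ n\<rfloor> * \<theta> ^ n" for n
    have pw: "\<theta> ^ n \<in> Z_adjoin \<theta>" "cj (\<theta> ^ n) = inverse \<theta> ^ n" for n
      using power_conj[OF Z_adjoin_theta, of n] by simp_all
    have cj: "cj (f n) = of_int \<lfloor>r * \<theta> ^ n\<rfloor> * inverse \<theta> ^ n" for n
    proof -
      have "cj (f n) = cj (of_int \<lfloor>r * \<theta> ^ n\<rfloor>) * cj (\<theta> ^ n)"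
        unfolding f_def using pw(1)[of n] Z_adjoin_subset Z_adjoin_of_int by (intro conj_mult) auto
      then show ?thesis
        using conj_of_int[of "\<lfloor>r * \<theta> ^ n\<rfloor>" 0] pw(2)[of n] by simp
    qed
    have "norm (cj (f n) - r) \<le> inverse \<theta> ^ n" for n
    proof -
      have "cj (f n) - r = (of_int \<lfloor>r * \<theta> ^ n\<rfloor> - r * \<theta> ^ n) * inverse \<theta> ^ n"
        using pos by (simp add: cj left_diff_distrib power_inverse)
      moreover have "\<bar>of_int \<lfloor>r * \<theta> ^ n\<rfloor> - r * \<theta> ^ n\<bar> \<le> 1"
        by linarith
      ultimately show ?thesis
        using pos by (simp add: abs_mult mult_left_le_one_le)
    qed
    moreover have "(\<lambda>n. inverse \<theta> ^ n) \<longlonglongrightarrow> 0"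
      using gt_1 by (intro LIMSEQ_power_zero) (simp add: inverse_less_1_iff)
    ultimately have "(\<lambda>n. cj (f n) - r) \<longlonglongrightarrow> 0"
      using Lim_null_comparison[of "\<lambda>n. cj (f n) - r" "\<lambda>n. inverse \<theta> ^ n" sequentially] by simp
    then have "(\<lambda>n. cj (f n)) \<longlonglongrightarrow> r"
      by (simp add: LIM_zero_iff)
    moreover have "f n \<in> int_ring \<theta>" for n
      unfolding int_ring_eq f_def using pw by (intro Z_adjoin_mult) simp_all
    ultimately have "f \<in> carrier R \<and> conj_lim f = r"
      by (intro carrierI)
    then show ?thesis
      by blast
  qed
  then show ?thesis
    by blast
qed

section \<open>The quotient field and its real coordinate\<close>

abbreviation K :: "(nat \<Rightarrow> real) set ring" where
  "K \<equiv> completion a \<theta>"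

lemma carrier_completion: "carrier K = (\<lambda>f. null_ideal a \<theta> +>\<^bsub>R\<^esub> f) ` carrier R"
  unfolding completion_def FactRing_def A_RCOSETS_def' by auto

text \<open>The induced map of the first isomorphism theorem: \<open>conj_lim\<close> is constant on
  cosets of its kernel, so the image of a class is a singleton.\<close>

definition to_real :: "(nat \<Rightarrow> real) set \<Rightarrow> real" where
  "to_real H = the_elem (conj_lim ` H)"

lemma to_real_iso: "to_real \<in> ring_iso K real_ring"
  using lim_hom.FactRing_iso_set conj_lim_surj
  unfolding kernel_conj_lim completion_def to_real_def[abs_def] by simp

lemma to_real_coset: "f \<in> carrier R \<Longrightarrow> to_real (null_ideal a \<theta> +>\<^bsub>R\<^esub> f) = conj_lim f"
  using lim_hom.the_elem_simp unfolding kernel_conj_lim to_real_def by blast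

lemma field_completion: "field K"
proof -
  have "ring K"
    unfolding completion_def kernel_conj_lim[symmetric]
    by (rule ideal.quotient_is_ring[OF lim_hom.kernel_is_ideal])
  then interpret K: ring K .
  have inv: "inv_into (carrier K) to_real \<in> ring_iso real_ring K"
    using ring_iso_set_sym[OF \<open>ring K\<close> to_real_iso] .
  have "inv_into (carrier K) to_real \<zero>\<^bsub>real_ring\<^esub> = \<zero>\<^bsub>K\<^esub>"
    by (rule ring_hom_zero[OF _ field.is_ring[OF field_real_ring] \<open>ring K\<close>])
      (use inv in \<open>simp add: ring_iso_def del: real_ring_simps\<close>)
  \<comment> \<open>The transport of the field property yields \<open>K\<close> with its zero
    replaced by the image of zero; this update changes nothing.\<close>
  then have "K\<lparr>zero := inv_into (carrier K) to_real \<zero>\<^bsub>real_ring\<^esub>\<rparr> = K"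
    by simp
  then show ?thesis
    using field.ring_iso_imp_img_field[OF field_real_ring inv] by (simp only:)
qed

sublocale K: field K
  by (rule field_completion)

lemma inj_on_to_real: "inj_on to_real (carrier K)"
  and to_real_image: "to_real ` carrier K = UNIV"
  using ring_iso_memE(5)[OF to_real_iso] by (auto simp: bij_betw_def)

lemma to_real_add: "F \<in> carrier K \<Longrightarrow> G \<in> carrier K \<Longrightarrow> to_real (F \<oplus>\<^bsub>K\<^esub> G) = to_real F + to_real G"
  and to_real_mult: "F \<in> carrier K \<Longrightarrow> G \<in> carrier K \<Longrightarrow> to_real (F \<otimes>\<^bsub>K\<^esub> G) = to_real F * to_real G"
  and to_real_one: "to_real \<one>\<^bsub>K\<^esub> = 1"
  using ring_iso_memE(2-4)[OF to_real_iso] by simp_all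

lemma to_real_zero: "to_real \<zero>\<^bsub>K\<^esub> = 0"
  using to_real_add[of "\<zero>\<^bsub>K\<^esub>" "\<zero>\<^bsub>K\<^esub>"] by simp

lemma to_real_uminus: "F \<in> carrier K \<Longrightarrow> to_real (\<ominus>\<^bsub>K\<^esub> F) = - to_real F"
  using to_real_add[of F "\<ominus>\<^bsub>K\<^esub> F"] by (simp add: K.r_neg to_real_zero)

lemma to_real_minus:
  "F \<in> carrier K \<Longrightarrow> G \<in> carrier K \<Longrightarrow> to_real (F \<ominus>\<^bsub>K\<^esub> G) = to_real F - to_real G"
  by (simp add: a_minus_def to_real_add to_real_uminus)

lemma to_real_inv:
  assumes "F \<in> carrier K - {\<zero>\<^bsub>K\<^esub>}"
  shows "to_real (inv\<^bsub>K\<^esub> F) = inverse (to_real F)" "to_real F \<noteq> 0" "inv\<^bsub>K\<^esub> F \<in> carrier K"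
proof -
  have F: "F \<in> Units K"
    using assms by (simp only: K.field_Units)
  then have "to_real F * to_real (inv\<^bsub>K\<^esub> F) = 1"
    using to_real_mult[of F "inv\<^bsub>K\<^esub> F"] assms by (simp add: to_real_one)
  then show "to_real (inv\<^bsub>K\<^esub> F) = inverse (to_real F)" "to_real F \<noteq> 0"
    using inverse_unique by force+
  show "inv\<^bsub>K\<^esub> F \<in> carrier K"
    using F by simp
qed

subsection \<open>The inframetric topology\<close>

text \<open>The maximum in \<open>completion_abs\<close> exists because the nonzero values of \<open>theta_abs\<close> are powers of
  \<open>\<theta>\<close>, of which only finitely many can occur as limits for a given class.\<close>

lemma completion_abs_bounds:
  assumes "H \<in> carrier K"
  shows "completion_abs a \<theta> H \<le> ereal \<bar>to_real H\<bar>"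
    and "ereal (\<bar>to_real H\<bar> / ratio) \<le> completion_abs a \<theta> H"
proof -
  define r where "r = \<bar>to_real H\<bar>"
  define S where "S = {v. \<exists>h\<in>H. v = limsup (\<lambda>i. ereal (theta_abs a \<theta> (h i)))}"
  obtain f where f: "f \<in> carrier R" and H: "H = null_ideal a \<theta> +>\<^bsub>R\<^esub> f"
    using assms unfolding carrier_completion by blast
  \<comment> \<open>Representatives differ by null sequences, so one \<open>r\<close> serves the
    whole class.\<close>
  have mem: "h \<in> carrier R \<and> \<bar>conj_lim h\<bar> = r" if hH: "h \<in> H" for h
  proof -
    obtain k where k: "k \<in> null_ideal a \<theta>" and h: "h = (\<lambda>n. k n + f n)"
      using hH unfolding H a_r_coset_def' by auto
    have "k \<in> carrier R" "conj_lim k = 0"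
      using k unfolding kernel_conj_lim[symmetric] a_kernel_def' by simp_all
    then show ?thesis
      using add_carrier[OF _ f, of k] to_real_coset[OF f] unfolding h r_def H by simp
  qed
  have S_bounds: "v \<le> ereal r \<and> ereal (r / ratio) \<le> v" and S_finite: "v \<in> ereal ` (insert 0
      {y \<in> range (\<lambda>k. \<theta> powi k). r / ratio / 2 \<le> y \<and> y \<le> 2 * r})" (is "v \<in> ereal ` ?F")
    if vS: "v \<in> S" for v
  proof -
    obtain h where "h \<in> H" and v: "v = limsup (\<lambda>i. ereal (theta_abs a \<theta> (h i)))"
      using vS by (auto simp: S_def)
    then have h: "h \<in> carrier R" "(\<lambda>i. \<bar>cj (h i)\<bar>) \<longlonglongrightarrow> r"
      using mem tendsto_rabs[OF carrierD(3)[of h]] by auto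
    have "v \<le> limsup (\<lambda>i. ereal \<bar>cj (h i)\<bar>)"
      unfolding v by (rule Limsup_mono) (simp add: theta_abs_le carrierD[OF h(1)])
    also have "\<dots> = ereal r"
      using h(2) by (intro lim_imp_Limsup) simp_all
    finally have "v \<le> ereal r" .
    moreover have "ereal (r / ratio) = limsup (\<lambda>i. ereal (\<bar>cj (h i)\<bar> / ratio))"
      using h(2) by (intro lim_imp_Limsup[symmetric]) (auto intro!: tendsto_divide)
    moreover have "\<dots> \<le> v"
      unfolding v by (rule Limsup_mono)
        (use conj_le_theta_abs carrierD[OF h(1)] in \<open>simp add: field_simps\<close>)
    ultimately show bounds: "v \<le> ereal r \<and> ereal (r / ratio) \<le> v"
      by simp
    show "v \<in> ereal ` ?F"
    proof (cases "r = 0")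
      case True
      then have "v = ereal 0"
        using bounds by (intro antisym) simp_all
      then show ?thesis
        by blast
    next
      case False
      then have "0 < r"
        by (simp add: r_def)
      \<comment> \<open>The factors 2 and 1/2 are slack: the conjugates only converge to modulus
        \<open>r\<close>, yet the values of \<open>theta_abs\<close> must eventually lie in a fixed
        compact range of positive numbers.\<close>
      have "eventually (\<lambda>i. r / 2 < \<bar>cj (h i)\<bar>) sequentially"
        using \<open>0 < r\<close> by (intro order_tendstoD[OF h(2)]) simp
      moreover have "eventually (\<lambda>i. \<bar>cj (h i)\<bar> < 2 * r) sequentially"
        using \<open>0 < r\<close> by (intro order_tendstoD[OF h(2)]) simp
      ultimately have "eventually (\<lambda>i. ereal (theta_abs a \<theta> (h i)) \<in> ereal ` ?F) sequentially"
      proof eventually_elim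
        case (elim i)
        have "r / 2 < ratio * theta_abs a \<theta> (h i)"
          using elim conj_le_theta_abs[of "h i"] carrierD[OF h(1)] by fastforce
        then have "r / ratio / 2 \<le> theta_abs a \<theta> (h i)"
          by (simp add: field_simps)
        moreover have "theta_abs a \<theta> (h i) \<le> 2 * r"
          using elim theta_abs_le[of "h i"] carrierD[OF h(1)] by fastforce
        moreover have "h i \<noteq> 0"
          using elim \<open>0 < r\<close> by auto
        ultimately show ?case
          using theta_abs_range[of "h i"] carrierD[OF h(1)] by auto
      qed
      moreover have "finite ?F"
        using finite_powi_between[OF gt_1, of "r / ratio / 2" "2 * r"] \<open>0 < r\<close> by simp
      ultimately show ?thesis
        unfolding v by (intro limsup_mem_finite) simp_all
    qed
  qed
  have "finite S"
  proof (cases "r = 0")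
    case True
    \<comment> \<open>For \<open>r = 0\<close> the range of powers has no positive lower end; here
      the two bounds already force every limsup to be 0.\<close>
    then have "S \<subseteq> {0}"
      using antisym S_bounds by (fastforce simp: zero_ereal_def)
    then show ?thesis
      by (rule finite_subset) simp
  next
    case False
    then have "0 < r / ratio / 2"
      by (simp add: r_def)
    then have "finite {y \<in> range (\<lambda>k. \<theta> powi k). r / ratio / 2 \<le> y \<and> y \<le> 2 * r}"
      by (intro finite_powi_between gt_1)
    then show ?thesis
      using S_finite by (meson finite_imageI finite_insert finite_subset subsetI)
  qed
  moreover have "S \<noteq> {}"
    using lim_hom.homeq_imp_rcos[OF f f] unfolding S_def H kernel_conj_lim by auto
  ultimately have Max: "Max S \<in> S" "\<And>v. v \<in> S \<Longrightarrow> v \<le> Max S"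
    by simp_all
  have "completion_abs a \<theta> H = Max S"
    unfolding completion_abs_def
    by (rule Greatest_equality) (use Max in \<open>auto simp: S_def\<close>)
  then show "completion_abs a \<theta> H \<le> ereal \<bar>to_real H\<bar>"
    "ereal (\<bar>to_real H\<bar> / ratio) \<le> completion_abs a \<theta> H"
    using S_bounds[OF Max(1)] by (simp_all add: r_def)
qed

text \<open>Balls are only squeezed between preimages of intervals, but a constant factor in the
  radius does not affect neighbourhood filters.\<close>

lemma completion_ball_subset:
  assumes "F \<in> carrier K"
  shows "completion_ball a \<theta> F \<epsilon> \<subseteq> {G \<in> carrier K. \<bar>to_real F - to_real G\<bar> < ratio * \<epsilon>}"
    and "{G \<in> carrier K. \<bar>to_real F - to_real G\<bar> < \<epsilon>} \<subseteq> completion_ball a \<theta> F \<epsilon>"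
proof -
  have bounds: "completion_abs a \<theta> (F \<ominus>\<^bsub>K\<^esub> G) \<le> ereal \<bar>to_real F - to_real G\<bar>"
    "ereal (\<bar>to_real F - to_real G\<bar> / ratio) \<le> completion_abs a \<theta> (F \<ominus>\<^bsub>K\<^esub> G)"
    if "G \<in> carrier K" for G
    using completion_abs_bounds[of "F \<ominus>\<^bsub>K\<^esub> G"] assms that by (simp_all add: to_real_minus)
  show "completion_ball a \<theta> F \<epsilon> \<subseteq> {G \<in> carrier K. \<bar>to_real F - to_real G\<bar> < ratio * \<epsilon>}"
  proof
    fix G assume G: "G \<in> completion_ball a \<theta> F \<epsilon>"
    then have "ereal (\<bar>to_real F - to_real G\<bar> / ratio) < ereal \<epsilon>"
      using bounds(2)[of G] unfolding completion_ball_def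
      by (metis (mono_tags, lifting) mem_Collect_eq order.strict_trans1)
    then show "G \<in> {G \<in> carrier K. \<bar>to_real F - to_real G\<bar> < ratio * \<epsilon>}"
      using G by (simp add: completion_ball_def field_simps)
  qed
  show "{G \<in> carrier K. \<bar>to_real F - to_real G\<bar> < \<epsilon>} \<subseteq> completion_ball a \<theta> F \<epsilon>"
    unfolding completion_ball_def by (auto intro: order.strict_trans1[OF bounds(1)])
qed

text \<open>The topology that turns \<open>to_real\<close> into a homeomorphism onto the real
  line.\<close>

abbreviation X :: "(nat \<Rightarrow> real) set topology" where
  "X \<equiv> pullback_topology (carrier K) to_real euclidean"

lemma topspace_X: "topspace X = carrier K"
  by (simp add: topspace_pullback_topology)

lemma X_neighbourhood_iff:
  assumes "F \<in> carrier K" "U \<subseteq> carrier K"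
  shows "(\<exists>V. openin X V \<and> F \<in> V \<and> V \<subseteq> U) \<longleftrightarrow> (\<exists>\<epsilon>>0. completion_ball a \<theta> F \<epsilon> \<subseteq> U)"
proof
  assume "\<exists>V. openin X V \<and> F \<in> V \<and> V \<subseteq> U"
  then obtain W where W: "open W" "to_real F \<in> W" "to_real -` W \<inter> carrier K \<subseteq> U"
    by (auto simp: openin_pullback_topology)
  then obtain e where e: "0 < e" "ball (to_real F) e \<subseteq> W"
    using open_contains_ball by blast
  \<comment> \<open>Dividing by \<open>ratio\<close> cancels the factor lost in the outer inclusion
    for balls.\<close>
  have "completion_ball a \<theta> F (e / ratio) \<subseteq> U"
  proof
    fix G assume "G \<in> completion_ball a \<theta> F (e / ratio)"
    then have "G \<in> carrier K" "\<bar>to_real F - to_real G\<bar> < e"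
      using completion_ball_subset(1)[OF assms(1), of "e / ratio"] by force+
    then show "G \<in> U"
      using e(2) W(3) by (force simp: dist_real_def)
  qed
  then show "\<exists>\<epsilon>>0. completion_ball a \<theta> F \<epsilon> \<subseteq> U"
    using e(1) by (intro exI[of _ "e / ratio"]) simp
next
  assume "\<exists>\<epsilon>>0. completion_ball a \<theta> F \<epsilon> \<subseteq> U"
  then obtain e where e: "0 < e" "completion_ball a \<theta> F e \<subseteq> U"
    by blast
  have "to_real -` ball (to_real F) e \<inter> carrier K \<subseteq> U"
    using completion_ball_subset(2)[OF assms(1), of e] e(2) by (auto simp: dist_real_def)
  moreover have "openin X (to_real -` ball (to_real F) e \<inter> carrier K)"
    by (auto simp: openin_pullback_topology)
  ultimately show "\<exists>V. openin X V \<and> F \<in> V \<and> V \<subseteq> U"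
    using assms(1) e(1) by (intro exI[of _ "to_real -` ball (to_real F) e \<inter> carrier K"]) auto
qed

text \<open>A topology is determined by its neighbourhood filters, since a set is open iff it is a
  neighbourhood of each of its points. Hence at most one topology fits the description, and
  \<open>X\<close> does.\<close>

lemma inframetric_topology_eq: "inframetric_topology a \<theta> = X"
  unfolding inframetric_topology_def
proof (rule the_equality)
  show "topspace X = carrier K \<and> (\<forall>F \<in> carrier K. \<forall>U \<subseteq> carrier K.
      (\<exists>V. openin X V \<and> F \<in> V \<and> V \<subseteq> U) \<longleftrightarrow> (\<exists>\<epsilon>>0. completion_ball a \<theta> F \<epsilon> \<subseteq> U))"
    by (intro conjI topspace_X ballI allI impI X_neighbourhood_iff)
next
  fix Y assume Y: "topspace Y = carrier K \<and> (\<forall>F \<in> carrier K. \<forall>U \<subseteq> carrier K.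
      (\<exists>V. openin Y V \<and> F \<in> V \<and> V \<subseteq> U) \<longleftrightarrow> (\<exists>\<epsilon>>0. completion_ball a \<theta> F \<epsilon> \<subseteq> U))"
  show "Y = X"
  proof (subst topology_eq, intro allI)
    fix S
    show "openin Y S \<longleftrightarrow> openin X S"
    proof (cases "S \<subseteq> carrier K")
      case True
      then have "(\<exists>V. openin Y V \<and> F \<in> V \<and> V \<subseteq> S) \<longleftrightarrow> (\<exists>V. openin X V \<and> F \<in> V \<and> V \<subseteq> S)"
        if "F \<in> S" for F
        using Y X_neighbourhood_iff[of F S] that by (meson subsetD)
      then show ?thesis
        unfolding openin_subopen[of Y S] openin_subopen[of X S] by blast
    next
      case False
      then show ?thesis
        using Y openin_subset topspace_X by metis
    qed
  qed
qed

section \<open>Continuity of the field operations, and the embedding\<close>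

lemma continuous_map_to_real: "continuous_map X euclidean to_real"
  using continuous_map_pullback[of euclidean euclidean id "carrier K" to_real] by simp

text \<open>Reduces each field operation to the continuity of its real counterpart
  \<open>r\<close>.\<close>

lemma continuous_map_into_X:
  assumes "continuous_map T euclidean (\<lambda>x. r x)"
    and "\<And>x. x \<in> topspace T \<Longrightarrow> g x \<in> carrier K \<and> to_real (g x) = r x"
  shows "continuous_map T X g"
proof (rule continuous_map_pullback')
  show "continuous_map T euclidean (to_real \<circ> g)"
    using assms by (auto intro: continuous_map_eq)
  show "topspace T \<subseteq> g -` carrier K"
    using assms(2) by blast
qed

lemma topological_field_completion: "topological_field K (inframetric_topology a \<theta>)"
  unfolding topological_field_def inframetric_topology_eq
proof (intro conjI field_completion topspace_X)
  have fst: "continuous_map (prod_topology X X) euclidean (\<lambda>p. to_real (fst p))"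
    and snd: "continuous_map (prod_topology X X) euclidean (\<lambda>p. to_real (snd p))"
    using continuous_map_compose[OF continuous_map_fst continuous_map_to_real]
      continuous_map_compose[OF continuous_map_snd continuous_map_to_real] by (auto simp: o_def)
  show "continuous_map (prod_topology X X) X (\<lambda>(x, y). x \<oplus>\<^bsub>K\<^esub> y)"
    by (rule continuous_map_into_X[OF continuous_map_add[OF fst snd]])
      (auto simp: topspace_X to_real_add)
  show "continuous_map (prod_topology X X) X (\<lambda>(x, y). x \<otimes>\<^bsub>K\<^esub> y)"
    by (rule continuous_map_into_X[OF continuous_map_real_mult[OF fst snd]])
      (auto simp: topspace_X to_real_mult)
  show "continuous_map X X (\<lambda>x. \<ominus>\<^bsub>K\<^esub> x)"
    by (rule continuous_map_into_X[OF continuous_map_minus[OF continuous_map_to_real]])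
      (auto simp: topspace_X to_real_uminus)
  show "continuous_map (subtopology X (carrier K - {\<zero>\<^bsub>K\<^esub>})) X (\<lambda>x. inv\<^bsub>K\<^esub> x)"
    by (rule continuous_map_into_X[OF continuous_map_real_inverse[OF
          continuous_map_from_subtopology[OF continuous_map_to_real]]])
      (auto simp: topspace_X to_real_inv)
qed

text \<open>Conjugation is defined on the whole field, so it can be followed by the inverse of
  \<open>to_real\<close>. On integers this agrees with the constant sequences, as both classes have
  real coordinate \<open>cj \<alpha>\<close>.\<close>

lemma embedding_exists:
  "\<exists>\<iota>. \<iota> \<in> ring_hom (quad_field_ring \<theta>) K \<and> inj_on \<iota> (quad_field \<theta>) \<and>
     (\<forall>\<alpha> \<in> int_ring \<theta>. \<iota> \<alpha> = const_embed a \<theta> \<alpha>)"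
proof -
  define \<iota> where "\<iota> = inv_into (carrier K) to_real \<circ> cj"
  have "inv_into (carrier K) to_real \<in> ring_iso real_ring K"
    by (rule ring_iso_set_sym[OF K.ring_axioms to_real_iso])
  moreover have "cj \<in> ring_hom (quad_field_ring \<theta>) real_ring"
    by (rule ring_hom_memI) (simp_all add: quad_field_ring_def conj_mult conj_add)
  ultimately have "\<iota> \<in> ring_hom (quad_field_ring \<theta>) K"
    unfolding \<iota>_def by (intro ring_hom_trans) (auto simp: ring_iso_def)
  moreover have "inj_on \<iota> (quad_field \<theta>)"
    unfolding \<iota>_def
    by (rule comp_inj_on[OF inj_on_conj]) (simp add: inj_on_inv_into to_real_image)
  moreover have "\<iota> \<alpha> = const_embed a \<theta> \<alpha>" if \<alpha>: "\<alpha> \<in> int_ring \<theta>" for \<alpha>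
  proof -
    have "const_embed a \<theta> \<alpha> \<in> carrier K"
      using const_carrier[OF \<alpha>]
      unfolding const_embed_def carrier_completion by blast
    moreover have "to_real (const_embed a \<theta> \<alpha>) = cj \<alpha>"
      using const_carrier[OF \<alpha>] by (simp add: const_embed_def to_real_coset)
    ultimately show ?thesis
      unfolding \<iota>_def using inv_into_f_eq[OF inj_on_to_real] by simp
  qed
  ultimately show ?thesis
    by blast
qed

end

theorem theorem32:
  fixes a :: int and \<theta> :: real
  assumes "a \<ge> 3" and "\<theta> > 1" and "\<theta>\<^sup>2 = of_int a * \<theta> - 1"
    and "int_ring \<theta> = Z_adjoin \<theta>"
  shows "topological_field (completion a \<theta>) (inframetric_topology a \<theta>) \<and>
         (\<exists>\<iota>. \<iota> \<in> ring_hom (quad_field_ring \<theta>) (completion a \<theta>) \<and>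
              inj_on \<iota> (quad_field \<theta>) \<and>
              (\<forall>\<alpha> \<in> int_ring \<theta>. \<iota> \<alpha> = const_embed a \<theta> \<alpha>))"
proof -
  interpret maximal_quadratic_unit a \<theta>
    using assms by unfold_locales auto
  show ?thesis
    using topological_field_completion embedding_exists by blast
qed

end
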